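(* Let $H$ be a finite dimensional Hilbert space, let $B$ be a unital $C^*$-algebra acting on $H$, and let $\mathrm{Tr}$ denote the usual trace on $B(H)$. Suppose $\phi\colon B\to B$ is a unital positive linear map which is trace preserving, i.e. $\mathrm{Tr}(\phi(a))=\mathrm{Tr}(a)$ for all $a\in B$. Let $B_\phi=\{a\in B:\phi(a)=a\}$ and let $P_\phi\colon B\to B_\phi$ be the $\phi$-invariant positive projection of $B$ onto $B_\phi$. If $\phi$ is $(2,2)$-decomposable, then $P_\phi$ is decomposable, and $(B_\phi)_{sa}$ is a reversible Jordan algebra. In particular, if $(B_\phi)_{sa}$ is nonreversible, then $\phi$ is atomic.
   Context: For a $*$-closed subspace $C$ of a $C^*$-algebra, $C_{sa}$ denotes its self-adjoint part. A projection map on $B$ is a positive linear map $P\colon B\to B$ with $P(1)=1$ and $P^2=P$. It is known that if $B$ is finite dimensional, $\phi\colon B\to B$ is positive and unital, and there is a faithful $\phi$-invariant state on $B$ (here the normalized trace), then there is a faithful positive projection map $P_\phi$ of $B$ onto $B_\phi$ which is $\phi$-invariant, i.e. $P_\phi\circ\phi=P_\phi$, and $(B_\phi)_{sa}$ is a Jordan subalgebra of $B_{sa}$ under $a\circ b=\frac12(ab+ba)$; $P_\phi$ is the limit of the averages $\frac1n\sum_{i=0}^{n-1}\phi^i$. A Jordan algebra $A\subset B_{sa}$ is reversible if $a_1a_2\cdots a_n+a_na_{n-1}\cdots a_1\in A$ for all $n$ and all $a_1,\dots,a_n\in A$; otherwise it is nonreversible. A linear map $\phi$ between $C^*$-algebras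 is $k$-positive if $\phi\otimes\iota_k$ is positive, where $\iota_k$ is the identity map on $M_k(\mathbb{C})$; it is $k$-copositive if $\phi\otimes\theta_k$ is positive, where $\theta_k$ is the transpose map on $M_k(\mathbb{C})$. It is completely positive (respectively copositive) if it is $k$-positive (respectively $k$-copositive) for all $k$; equivalently to the latter, it is the composition of a completely positive map and an anti-automorphism. A positive map is decomposable if it is the sum of a completely positive map and a copositive map. It is $(2,2)$-decomposable if it is the sum of a 2-positive map and a 2-copositive map (either summand may be zero). A positive map is atomic if it is not $(2,2)$-decomposable. *)

theory Defs
  imports "HOL-Analysis.Analysis"
begin

text \<open>
  The finite dimensional Hilbert space is \<open>complex ^ 'n\<close> with its standard inner product, and
  operators on it are matrices. Products are always \<open>**\<close>: the class operation \<open>*\<close> on vectors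
  and matrices is componentwise. All maps are total functions on matrices of which only the values
  on the algebra \<open>B\<close> matter.
\<close>

definition hinner :: "complex ^ 'n \<Rightarrow> complex ^ 'n \<Rightarrow> complex" where
  "hinner x y = (\<Sum>i\<in>UNIV. x $ i * cnj (y $ i))"

definition mscale :: "complex \<Rightarrow> complex ^ 'n ^ 'n \<Rightarrow> complex ^ 'n ^ 'n" where
  "mscale c a = (\<chi> i j. c * a $ i $ j)"

definition mstar :: "complex ^ 'n ^ 'n \<Rightarrow> complex ^ 'n ^ 'n" where
  "mstar a = (\<chi> i j. cnj (a $ j $ i))"

text \<open>In finite dimension norm closedness is automatic.\<close>

definition unital_cstar_algebra :: "(complex ^ 'n ^ 'n) set \<Rightarrow> bool" where
  "unital_cstar_algebra B \<longleftrightarrow>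
     mat 1 \<in> B \<and>
     (\<forall>a\<in>B. \<forall>b\<in>B. a + b \<in> B \<and> a ** b \<in> B) \<and>
     (\<forall>c. \<forall>a\<in>B. mscale c a \<in> B) \<and>
     (\<forall>a\<in>B. mstar a \<in> B)"

definition self_adjoint_part :: "(complex ^ 'n ^ 'n) set \<Rightarrow> (complex ^ 'n ^ 'n) set" where
  "self_adjoint_part C = {a \<in> C. mstar a = a}"

definition positive_op :: "complex ^ 'n ^ 'n \<Rightarrow> bool" where
  "positive_op a \<longleftrightarrow> (\<forall>x. hinner (a *v x) x \<in> \<real>\<^sub>\<ge>\<^sub>0)"

text \<open>
  An element of \<open>B \<otimes> M\<^sub>k(\<complex>)\<close> is the \<open>k \<times> k\<close> block matrix \<open>X\<close> with entries \<open>X i j \<in> B\<close>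
  (\<open>i, j < k\<close>), standing for the sum of the \<open>X i j \<otimes> e\<^sub>i\<^sub>j\<close>; it acts on the direct sum of
  \<open>k\<close> copies of the Hilbert space.
\<close>

definition block_matrices ::
    "nat \<Rightarrow> (complex ^ 'n ^ 'n) set \<Rightarrow> (nat \<Rightarrow> nat \<Rightarrow> complex ^ 'n ^ 'n) set" where
  "block_matrices k B = {X. \<forall>i<k. \<forall>j<k. X i j \<in> B}"

definition block_positive :: "nat \<Rightarrow> (nat \<Rightarrow> nat \<Rightarrow> complex ^ 'n ^ 'n) \<Rightarrow> bool" where
  "block_positive k X \<longleftrightarrow>
     (\<forall>\<xi> :: nat \<Rightarrow> complex ^ 'n.
        (\<Sum>i<k. hinner (\<Sum>j<k. X i j *v \<xi> j) (\<xi> i)) \<in> \<real>\<^sub>\<ge>\<^sub>0)"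

text \<open>The maps \<open>\<phi> \<otimes> \<iota>\<^sub>k\<close> and \<open>\<phi> \<otimes> \<theta>\<^sub>k\<close> (identity and transpose on \<open>M\<^sub>k(\<complex>)\<close>).\<close>

definition tensor_identity ::
    "(complex ^ 'n ^ 'n \<Rightarrow> complex ^ 'n ^ 'n) \<Rightarrow>
     (nat \<Rightarrow> nat \<Rightarrow> complex ^ 'n ^ 'n) \<Rightarrow> nat \<Rightarrow> nat \<Rightarrow> complex ^ 'n ^ 'n" where
  "tensor_identity \<phi> X = (\<lambda>i j. \<phi> (X i j))"

definition tensor_transpose ::
    "(complex ^ 'n ^ 'n \<Rightarrow> complex ^ 'n ^ 'n) \<Rightarrow>
     (nat \<Rightarrow> nat \<Rightarrow> complex ^ 'n ^ 'n) \<Rightarrow> nat \<Rightarrow> nat \<Rightarrow> complex ^ 'n ^ 'n" where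
  "tensor_transpose \<phi> X = (\<lambda>i j. \<phi> (X j i))"

definition linear_map_on ::
    "(complex ^ 'n ^ 'n) set \<Rightarrow> (complex ^ 'n ^ 'n \<Rightarrow> complex ^ 'n ^ 'n) \<Rightarrow> bool" where
  "linear_map_on B \<phi> \<longleftrightarrow>
     \<phi> ` B \<subseteq> B \<and>
     (\<forall>a\<in>B. \<forall>b\<in>B. \<phi> (a + b) = \<phi> a + \<phi> b) \<and>
     (\<forall>c. \<forall>a\<in>B. \<phi> (mscale c a) = mscale c (\<phi> a))"

definition positive_map ::
    "(complex ^ 'n ^ 'n) set \<Rightarrow> (complex ^ 'n ^ 'n \<Rightarrow> complex ^ 'n ^ 'n) \<Rightarrow> bool" where
  "positive_map B \<phi> \<longleftrightarrow>
     linear_map_on B \<phi> \<and> (\<forall>a\<in>B. positive_op a \<longrightarrow> positive_op (\<phi> a))"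

definition k_positive ::
    "nat \<Rightarrow> (complex ^ 'n ^ 'n) set \<Rightarrow> (complex ^ 'n ^ 'n \<Rightarrow> complex ^ 'n ^ 'n) \<Rightarrow> bool" where
  "k_positive k B \<phi> \<longleftrightarrow>
     linear_map_on B \<phi> \<and>
     (\<forall>X\<in>block_matrices k B. block_positive k X \<longrightarrow> block_positive k (tensor_identity \<phi> X))"

definition k_copositive ::
    "nat \<Rightarrow> (complex ^ 'n ^ 'n) set \<Rightarrow> (complex ^ 'n ^ 'n \<Rightarrow> complex ^ 'n ^ 'n) \<Rightarrow> bool" where
  "k_copositive k B \<phi> \<longleftrightarrow>
     linear_map_on B \<phi> \<and>
     (\<forall>X\<in>block_matrices k B. block_positive k X \<longrightarrow> block_positive k (tensor_transpose \<phi> X))"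

definition completely_positive ::
    "(complex ^ 'n ^ 'n) set \<Rightarrow> (complex ^ 'n ^ 'n \<Rightarrow> complex ^ 'n ^ 'n) \<Rightarrow> bool" where
  "completely_positive B \<phi> \<longleftrightarrow> (\<forall>k\<ge>1. k_positive k B \<phi>)"

definition copositive ::
    "(complex ^ 'n ^ 'n) set \<Rightarrow> (complex ^ 'n ^ 'n \<Rightarrow> complex ^ 'n ^ 'n) \<Rightarrow> bool" where
  "copositive B \<phi> \<longleftrightarrow> (\<forall>k\<ge>1. k_copositive k B \<phi>)"

definition decomposable ::
    "(complex ^ 'n ^ 'n) set \<Rightarrow> (complex ^ 'n ^ 'n \<Rightarrow> complex ^ 'n ^ 'n) \<Rightarrow> bool" where
  "decomposable B \<phi> \<longleftrightarrow>
     positive_map B \<phi> \<and>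
     (\<exists>\<phi>1 \<phi>2. completely_positive B \<phi>1 \<and> copositive B \<phi>2 \<and> (\<forall>a\<in>B. \<phi> a = \<phi>1 a + \<phi>2 a))"

definition two_two_decomposable ::
    "(complex ^ 'n ^ 'n) set \<Rightarrow> (complex ^ 'n ^ 'n \<Rightarrow> complex ^ 'n ^ 'n) \<Rightarrow> bool" where
  "two_two_decomposable B \<phi> \<longleftrightarrow>
     positive_map B \<phi> \<and>
     (\<exists>\<phi>1 \<phi>2. k_positive 2 B \<phi>1 \<and> k_copositive 2 B \<phi>2 \<and> (\<forall>a\<in>B. \<phi> a = \<phi>1 a + \<phi>2 a))"

definition atomic_map ::
    "(complex ^ 'n ^ 'n) set \<Rightarrow> (complex ^ 'n ^ 'n \<Rightarrow> complex ^ 'n ^ 'n) \<Rightarrow> bool" where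
  "atomic_map B \<phi> \<longleftrightarrow> positive_map B \<phi> \<and> \<not> two_two_decomposable B \<phi>"

definition fixed_points ::
    "(complex ^ 'n ^ 'n) set \<Rightarrow> (complex ^ 'n ^ 'n \<Rightarrow> complex ^ 'n ^ 'n) \<Rightarrow> (complex ^ 'n ^ 'n) set"
  where "fixed_points B \<phi> = {a \<in> B. \<phi> a = a}"

definition projection_map ::
    "(complex ^ 'n ^ 'n) set \<Rightarrow> (complex ^ 'n ^ 'n \<Rightarrow> complex ^ 'n ^ 'n) \<Rightarrow> bool" where
  "projection_map B P \<longleftrightarrow>
     positive_map B P \<and> P (mat 1) = mat 1 \<and> (\<forall>a\<in>B. P (P a) = P a)"

text \<open>
  For unital trace preserving positive \<open>\<phi>\<close> these conditions determine \<open>P\<close> on \<open>B\<close>: it is the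
  limit of the averages of the powers of \<open>\<phi>\<close>.
\<close>

definition invariant_projection ::
    "(complex ^ 'n ^ 'n) set \<Rightarrow> (complex ^ 'n ^ 'n \<Rightarrow> complex ^ 'n ^ 'n) \<Rightarrow>
     (complex ^ 'n ^ 'n \<Rightarrow> complex ^ 'n ^ 'n) \<Rightarrow> bool" where
  "invariant_projection B \<phi> P \<longleftrightarrow>
     projection_map B P \<and> P ` B = fixed_points B \<phi> \<and> (\<forall>a\<in>B. P (\<phi> a) = P a)"

definition jordan_product :: "complex ^ 'n ^ 'n \<Rightarrow> complex ^ 'n ^ 'n \<Rightarrow> complex ^ 'n ^ 'n" where
  "jordan_product a b = (1/2) *\<^sub>R (a ** b + b ** a)"

text \<open>Jordan subalgebras of the self-adjoint part are real linear; \<open>subspace\<close> is the real notion.\<close>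

definition jordan_subalgebra :: "(complex ^ 'n ^ 'n) set \<Rightarrow> (complex ^ 'n ^ 'n) set \<Rightarrow> bool" where
  "jordan_subalgebra B A \<longleftrightarrow>
     A \<subseteq> self_adjoint_part B \<and> subspace A \<and> (\<forall>a\<in>A. \<forall>b\<in>A. jordan_product a b \<in> A)"

definition mprod :: "(complex ^ 'n ^ 'n) list \<Rightarrow> complex ^ 'n ^ 'n" where
  "mprod as = foldr (**) as (mat 1)"

definition reversible :: "(complex ^ 'n ^ 'n) set \<Rightarrow> bool" where
  "reversible A \<longleftrightarrow>
     (\<forall>as. as \<noteq> [] \<and> set as \<subseteq> A \<longrightarrow> mprod as + mprod (rev as) \<in> A)"

end

theory Submission
  imports Defs "HOL-Complex_Analysis.Great_Picard"
begin

text \<open>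
  Write \<open>\<phi> = \<phi>1 + \<phi>2\<close> with \<open>\<phi>1\<close> 2-positive and \<open>\<phi>2\<close> 2-copositive, and let \<open>a\<close> be a self-adjoint fixed
  point. Kadison's inequality \<open>\<phi>(a\<^sup>2) \<ge> a\<^sup>2\<close> is an equality because \<open>\<phi>\<close> preserves the trace. It is the
  sum of the Kadison inequalities for the two summands, each taken at the vectors \<open>(\<xi>, - a \<xi>)\<close>, so
  these are equalities too. Choi's multiplicative domain argument, which needs Kadison's inequality
  for all operators and hence 2-positivity, now gives
  \<open>\<phi>1(a x) = a \<phi>1(x)\<close> and \<open>\<phi>2(a x) = \<phi>2(x) a\<close> for all \<open>x\<close> in \<open>B\<close>, together with the adjoint identities
  (\<open>fixed_self_adjoint_module\<close>).

  For a word \<open>w\<close> in self-adjoint fixed points with reversal \<open>w\<^sup>r\<close> this means \<open>\<phi>1(w) = w h\<close> and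
  \<open>\<phi>2(w) = w\<^sup>r k\<close>, where \<open>h = \<phi>1(1)\<close> and \<open>k = \<phi>2(1)\<close> commute with the words and add up to 1. Hence
  \<open>\<phi>(w + w\<^sup>r) = w + w\<^sup>r\<close>, which is reversibility (\<open>reversible_fixed_points\<close>); words of length two give
  the Jordan product.

  For the projection \<open>P\<close>, the (2,2)-decomposable maps are closed under sums, positive multiples,
  compositions and limits. \<open>P\<close> is a limit of averages of powers of \<open>\<phi>\<close>, so it is again a trace
  preserving sum \<open>P1 + P2\<close> of a 2-positive and a 2-copositive map
  (\<open>invariant_projection_schwarz_decomposition\<close>). The elements with the module identities above for
  \<open>P1\<close> and \<open>P2\<close> form a *-algebra \<open>C\<close> containing the range of \<open>P\<close>. On \<open>C\<close>, \<open>P1\<close> is multiplication by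
  the positive operator \<open>P1(1)\<close> and \<open>P2\<close> is a reversal followed by multiplication by \<open>P2(1)\<close>, so they
  are completely positive and copositive there. Since \<open>P\<close> is the trace orthogonal projection onto its
  range, \<open>P = P E\<close> with \<open>E\<close> the trace preserving conditional expectation onto \<open>C\<close>, and
  \<open>P = P1 E + P2 E\<close> is the required decomposition (\<open>idempotent_decomposable\<close>).

  That \<open>P1 E\<close> and \<open>P2 E\<close> inherit complete (co)positivity from \<open>C\<close> is shown by trace duality
  (\<open>functionals_positive_cond_exp\<close>): a matrix of functionals that factor through \<open>E\<close> has a density with
  entries in \<open>C\<close>; positivity of the functionals on \<open>C\<close> makes the density a positive operator
  (\<open>positive_op_of_trace_form\<close>), and its trace against any positive block matrix is nonnegative.
\<close>

section \<open>Complex matrices as operators\<close>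

lemma mscale_nth [simp]: "mscale c a $ i $ j = c * a $ i $ j"
  by (simp add: mscale_def)

lemma mstar_nth [simp]: "mstar a $ i $ j = cnj (a $ j $ i)"
  by (simp add: mstar_def)

lemma mstar_mstar [simp]: "mstar (mstar a) = a"
  by (simp add: vec_eq_iff)

lemma mstar_add: "mstar (a + b) = mstar a + mstar b"
  by (simp add: vec_eq_iff)

lemma mstar_diff: "mstar (a - b) = mstar a - mstar b"
  by (simp add: vec_eq_iff)

lemma mstar_zero [simp]: "mstar 0 = 0"
  by (simp add: vec_eq_iff)

lemma mstar_mscale: "mstar (mscale c a) = mscale (cnj c) (mstar a)"
  by (simp add: vec_eq_iff)

lemma mstar_scaleR: "mstar (r *\<^sub>R a) = r *\<^sub>R mstar a"
  by (simp add: vec_eq_iff)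

lemma mstar_mult: "mstar (a ** b) = mstar b ** mstar a"
  by (simp add: vec_eq_iff matrix_matrix_mult_def mult.commute)

lemma mstar_one [simp]: "mstar (mat 1) = mat 1"
  by (simp add: vec_eq_iff mat_def)

lemma scaleR_mscale: "r *\<^sub>R a = mscale (of_real r) a"
  by (simp add: vec_eq_iff scaleR_conv_of_real[where 'a = complex])

lemma uminus_mscale: "- a = mscale (- 1) a"
  by (simp add: vec_eq_iff)

lemma mscale_add: "mscale c (a + b) = mscale c a + mscale c b"
  by (simp add: vec_eq_iff algebra_simps)

lemma mscale_mscale [simp]: "mscale c (mscale d a) = mscale (c * d) a"
  by (simp add: vec_eq_iff)

lemma mscale_zero [simp]: "mscale 0 a = 0" "mscale c 0 = 0" "mscale 1 a = a"
  by (simp_all add: vec_eq_iff)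

lemma mscale_scaleR: "mscale c (r *\<^sub>R a) = r *\<^sub>R mscale c a"
  by (simp add: vec_eq_iff)

lemma mscale_mult: "mscale c a ** b = mscale c (a ** b)" "a ** mscale c b = mscale c (a ** b)"
  by (simp_all add: vec_eq_iff matrix_matrix_mult_def sum_distrib_left ac_simps)

lemma mscale_apply: "mscale c a *v x = c *s (a *v x)"
  by (simp add: vec_eq_iff matrix_vector_mult_def sum_distrib_left ac_simps)

lemma matrix_scale_apply: "(a :: complex^'n^'m) *v (c *s x) = c *s (a *v x)"
  by (simp add: vec_eq_iff matrix_vector_mult_def sum_distrib_left ac_simps)

lemma matrix_uminus_apply: "(a :: complex^'n^'m) *v (- x) = - (a *v x)"
  by (simp add: vec_eq_iff matrix_vector_mult_def sum_negf)

lemma mult_diff: "(a :: complex^'n^'n) ** (b - c) = a ** b - a ** c"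
    "(b - c) ** (a :: complex^'n^'n) = b ** a - c ** a"
  by (simp_all add: vec_eq_iff matrix_matrix_mult_def sum_subtractf algebra_simps)

lemma mult_add: "(a :: complex^'n^'n) ** (b + c) = a ** b + a ** c"
    "(b + c) ** (a :: complex^'n^'n) = b ** a + c ** a"
  by (simp_all add: vec_eq_iff matrix_matrix_mult_def sum.distrib algebra_simps)

lemma mult_scaleR:
  fixes a b :: "complex^'n^'n"
  shows "(r *\<^sub>R a) ** b = r *\<^sub>R (a ** b)" "a ** (r *\<^sub>R b) = r *\<^sub>R (a ** b)"
  unfolding scaleR_mscale by (simp_all add: mscale_mult)

lemma mult_zero [simp]: "(0 :: complex^'n^'n) ** a = 0" "(a :: complex^'n^'n) ** 0 = 0"
  by (simp_all add: vec_eq_iff matrix_matrix_mult_def)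

lemma trace_mscale: "trace (mscale c a) = c * trace a"
  by (simp add: trace_def sum_distrib_left)

lemma hinner_add: "hinner (x + y) z = hinner x z + hinner y z"
    "hinner z (x + y) = hinner z x + hinner z y"
  by (simp_all add: hinner_def sum.distrib algebra_simps)

lemma hinner_diff: "hinner (x - y) z = hinner x z - hinner y z"
    "hinner z (x - y) = hinner z x - hinner z y"
  by (simp_all add: hinner_def sum_subtractf algebra_simps)

lemma hinner_uminus: "hinner (- x) z = - hinner x z" "hinner z (- x) = - hinner z x"
  by (simp_all add: hinner_def sum_negf)

lemma hinner_scale: "hinner (c *s x) y = c * hinner x y" "hinner x (c *s y) = cnj c * hinner x y"
  by (simp_all add: hinner_def sum_distrib_left ac_simps)

lemma hinner_zero [simp]: "hinner 0 x = 0" "hinner x 0 = 0"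
  by (simp_all add: hinner_def)

lemma hinner_sum: "hinner (\<Sum>i\<in>I. f i) y = (\<Sum>i\<in>I. hinner (f i) y)"
    "hinner y (\<Sum>i\<in>I. f i) = (\<Sum>i\<in>I. hinner y (f i))"
  by (induction I rule: infinite_finite_induct; simp add: hinner_add)+

lemma cnj_hinner: "cnj (hinner x y) = hinner y x"
  by (simp add: hinner_def mult.commute)

lemma hinner_mstar: "hinner (mstar a *v x) y = hinner x (a *v y)"
proof -
  have "hinner (mstar a *v x) y = (\<Sum>i\<in>UNIV. \<Sum>j\<in>UNIV. cnj (a $ j $ i) * x $ j * cnj (y $ i))"
    by (simp add: hinner_def matrix_vector_mult_def sum_distrib_right)
  also have "\<dots> = (\<Sum>j\<in>UNIV. \<Sum>i\<in>UNIV. cnj (a $ j $ i) * x $ j * cnj (y $ i))"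
    by (rule sum.swap)
  also have "\<dots> = hinner x (a *v y)"
    by (simp add: hinner_def matrix_vector_mult_def sum_distrib_left ac_simps)
  finally show ?thesis .
qed

lemma hinner_self: "hinner x x = of_real ((norm x)\<^sup>2)"
proof -
  have "(norm x)\<^sup>2 = (\<Sum>i\<in>UNIV. (cmod (x $ i))\<^sup>2)"
    unfolding norm_vec_def L2_set_def by (simp add: sum_nonneg)
  then show ?thesis
    by (simp only: hinner_def complex_norm_square of_real_sum)
qed

lemma hinner_self_nonneg: "hinner x x \<in> \<real>\<^sub>\<ge>\<^sub>0"
  by (simp add: hinner_self complex_nonneg_Reals_iff)

lemma hinner_self_eq_0: "hinner x x = 0 \<longleftrightarrow> x = 0"
  by (simp add: hinner_self)

lemma hinner_axis: "hinner (a *v axis j 1) (axis i 1) = a $ i $ j"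
  unfolding hinner_def
  by (simp add: matrix_vector_mul_component axis_def if_distrib[of cnj] if_distrib[of "times _"] matrix_vector_mult_def
      cong: if_cong)

lemma trace_mult_mstar: "trace (a ** mstar a) = of_real ((norm a)\<^sup>2)"
proof -
  have "trace (a ** mstar a) = (\<Sum>i\<in>UNIV. hinner (a $ i) (a $ i))"
    by (simp add: trace_def matrix_matrix_mult_def hinner_def)
  also have "\<dots> = of_real (\<Sum>i\<in>UNIV. (norm (a $ i))\<^sup>2)"
    by (simp add: hinner_self)
  also have "(\<Sum>i\<in>UNIV. (norm (a $ i))\<^sup>2) = (norm a)\<^sup>2"
    by (simp add: norm_vec_def[of a] L2_set_def sum_nonneg)
  finally show ?thesis .
qed

lemma trace_mult_mstar_eq_0: "trace (a ** mstar a) = 0 \<longleftrightarrow> a = 0"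
  by (simp add: trace_mult_mstar)

lemma inner_eq_Re_trace: "inner a b = Re (trace (a ** mstar b))"
  by (simp add: inner_vec_def trace_def matrix_matrix_mult_def inner_complex_def)

lemma nonneg_complex_sum: "(\<And>i. i \<in> I \<Longrightarrow> f i \<in> \<real>\<^sub>\<ge>\<^sub>0) \<Longrightarrow> (\<Sum>i\<in>I. f i) \<in> (\<real>\<^sub>\<ge>\<^sub>0 :: complex set)"
  by (induction I rule: infinite_finite_induct) (auto intro: nonneg_Reals_add_I)

lemma nonneg_complex_add_eq_0:
  fixes x y :: complex
  assumes "x \<in> \<real>\<^sub>\<ge>\<^sub>0" "y \<in> \<real>\<^sub>\<ge>\<^sub>0" "x + y = 0"
  shows "x = 0" "y = 0"
  using assms by (auto simp: complex_nonneg_Reals_iff complex_eq_iff)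

text \<open>
  If a nonnegative Hermitian form vanishes at a vector, perturbing that vector in an arbitrary
  complex direction shows that the first order coefficients vanish too. This is the equality case
  of the Cauchy--Schwarz inequality for semidefinite forms.
\<close>

lemma first_order_vanishes:
  fixes u v N :: complex
  assumes pos: "\<And>t. t * u + cnj t * v + cnj t * t * N \<in> \<real>\<^sub>\<ge>\<^sub>0"
  shows "u = 0" "v = 0"
proof -
  have 1: "Im (u + v + N) = 0" "Im (- u - v + N) = 0" "Im (\<i> * u - \<i> * v + N) = 0"
    "Im (- \<i> * u + \<i> * v + N) = 0" "0 \<le> Re (u + v + N)" "0 \<le> Re (- u - v + N)"
    using pos[of 1] pos[of "-1"] pos[of \<i>] pos[of "- \<i>"]
    by (simp_all add: complex_nonneg_Reals_iff)
  have N: "Im N = 0" "0 \<le> Re N" and v: "v = cnj u"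
    using 1 by (auto simp: complex_eq_iff)
  have "u = 0"
  proof (rule ccontr)
    assume "u \<noteq> 0"
    \<comment> \<open>\<open>t = - e u\<^sup>*\<close> with \<open>e\<close> so small that the second order term stays below the first order one\<close>
    define e where "e = 1 / (1 + Re N)"
    have e: "0 < e" "e * Re N < 1"
      using N by (simp_all add: e_def field_simps)
    have "0 \<le> Re (- (of_real e * cnj u) * u + cnj (- (of_real e * cnj u)) * v
        + cnj (- (of_real e * cnj u)) * (- (of_real e * cnj u)) * N)"
      using pos[of "- (of_real e * cnj u)"] by (simp only: complex_nonneg_Reals_iff)
    also have "\<dots> = (cmod u)\<^sup>2 * (e * (e * Re N - 2))"
      using N unfolding cmod_power2 by (simp add: v algebra_simps power2_eq_square)
    finally have "0 \<le> (cmod u)\<^sup>2 * (e * (e * Re N - 2))" .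
    moreover have "(cmod u)\<^sup>2 * (e * (e * Re N - 2)) < 0"
      using \<open>u \<noteq> 0\<close> e by (intro mult_pos_neg) auto
    ultimately show False by simp
  qed
  then show "u = 0" "v = 0" by (simp_all add: v)
qed

lemma operator_eq_0:
  assumes "\<And>x. hinner (a *v x) x = 0"
  shows "a = 0"
proof -
  have u: "hinner (a *v y) x = 0" for x y
  proof (rule first_order_vanishes(1))
    fix t :: complex
    have "0 = hinner (a *v (x + t *s y)) (x + t *s y)"
      using assms by simp
    also have "\<dots> = t * hinner (a *v y) x + cnj t * hinner (a *v x) y + cnj t * t * 0"
      by (simp add: matrix_vector_right_distrib matrix_scale_apply hinner_add hinner_scale assms)
    finally show "t * hinner (a *v y) x + cnj t * hinner (a *v x) y + cnj t * t * 0 \<in> \<real>\<^sub>\<ge>\<^sub>0"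
      by (metis nonneg_Reals_zero_I)
  qed
  show ?thesis
    by (simp add: vec_eq_iff hinner_axis[symmetric] u)
qed

lemma positive_op_kernel:
  assumes "positive_op a" "hinner (a *v x) x = 0"
  shows "a *v x = 0"
proof -
  have "hinner (a *v x) (a *v x) = 0"
  proof (rule first_order_vanishes(2))
    fix t :: complex
    let ?y = "a *v x"
    have "hinner (a *v (x + t *s ?y)) (x + t *s ?y)
        = t * hinner (a *v ?y) x + cnj t * hinner (a *v x) ?y + cnj t * t * hinner (a *v ?y) ?y"
      by (simp add: matrix_vector_right_distrib matrix_scale_apply hinner_add hinner_scale assms
          algebra_simps)
    then show "t * hinner (a *v ?y) x + cnj t * hinner (a *v x) ?y + cnj t * t * hinner (a *v ?y) ?y \<in> \<real>\<^sub>\<ge>\<^sub>0"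
      using assms(1) unfolding positive_op_def by metis
  qed
  then show ?thesis by (simp add: hinner_self_eq_0)
qed

lemma positive_op_diag: "positive_op a \<Longrightarrow> a $ i $ i \<in> \<real>\<^sub>\<ge>\<^sub>0"
  by (metis positive_op_def hinner_axis)

lemma positive_op_trace: "positive_op a \<Longrightarrow> trace a \<in> \<real>\<^sub>\<ge>\<^sub>0"
  unfolding trace_def by (intro nonneg_complex_sum positive_op_diag)

lemma positive_op_trace_eq_0:
  assumes "positive_op a" "trace a = 0"
  shows "a = 0"
proof -
  have re: "(\<Sum>i\<in>UNIV. Re (a $ i $ i)) = 0"
    using assms(2) by (simp add: trace_def complex_eq_iff)
  have "a $ i $ i = 0" for i
    using positive_op_diag[OF assms(1)] re
    by (auto simp: sum_nonneg_eq_0_iff complex_nonneg_Reals_iff complex_eq_iff)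
  then have "a *v axis i 1 = 0" for i
    by (simp add: positive_op_kernel[OF assms(1)] hinner_axis)
  then show ?thesis
    by (metis hinner_axis hinner_zero(1) vec_eq_iff zero_index)
qed

lemma positive_op_hermitian:
  assumes "positive_op a"
  shows "mstar a = a"
proof -
  have "hinner ((mstar a - a) *v x) x = 0" for x
  proof -
    have "hinner (mstar a *v x) x = cnj (hinner (a *v x) x)"
      by (simp add: hinner_mstar cnj_hinner)
    moreover have "hinner (a *v x) x \<in> \<real>\<^sub>\<ge>\<^sub>0"
      using assms by (simp add: positive_op_def)
    ultimately show ?thesis
      by (simp add: matrix_vector_mult_diff_rdistrib hinner_diff complex_nonneg_Reals_iff complex_eq_iff)
  qed
  then show ?thesis
    using operator_eq_0[of "mstar a - a"] by simp
qed

section \<open>Trace form and positivity\<close>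

definition rank_one :: "complex^'n \<Rightarrow> complex^'n^'n" where
  "rank_one v = (\<chi> i j. v $ i * cnj (v $ j))"

lemma rank_one_apply: "rank_one v *v x = hinner x v *s v"
  by (simp add: vec_eq_iff rank_one_def matrix_vector_mult_def hinner_def sum_distrib_right
      sum_distrib_left ac_simps)

lemma trace_mult_rank_one: "trace (a ** rank_one v) = hinner (a *v v) v"
  by (simp add: trace_def matrix_matrix_mult_def rank_one_def hinner_def matrix_vector_mult_def
      sum_distrib_right mult.assoc)

text \<open>
  A positive operator is a sum of rank one operators: subtracting \<open>v v\<^sup>*\<close> for
  \<open>v = a e\<^sub>i / \<surd>a\<^sub>i\<^sub>i\<close> (one step of a Cholesky factorisation) keeps positivity, because
  its form at \<open>x\<close> is the form of \<open>a\<close> at \<open>x - s e\<^sub>i\<close> for the minimising \<open>s\<close>, and it annihilates the \<open>i\<close>-th diagonal entry while no vanishing diagonal entry becomes nonzero. This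
  replaces square roots and the spectral theorem.
\<close>

lemma positive_op_Cholesky_step:
  assumes a: "positive_op a" and i: "a $ i $ i \<noteq> 0"
  defines "v \<equiv> of_real (1 / sqrt (Re (a $ i $ i))) *s (a *v axis i 1)"
  shows "positive_op (a - rank_one v)" "(a - rank_one v) $ i $ i = 0"
    "a $ j $ j = 0 \<Longrightarrow> (a - rank_one v) $ j $ j = 0"
proof -
  define d where "d = Re (a $ i $ i)"
  have d: "a $ i $ i = of_real d" "d > 0"
    using positive_op_diag[OF a, of i] i by (auto simp: d_def complex_nonneg_Reals_iff complex_eq_iff)
  have sq: "of_real (1 / sqrt d) * of_real (1 / sqrt d) = (1 / of_real d :: complex)"
    using d by (simp flip: of_real_mult)
  have v: "rank_one v *v x = (hinner x (a *v axis i 1) / of_real d) *s (a *v axis i 1)" for x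
    unfolding rank_one_apply v_def d_def[symmetric]
    using d by (simp add: hinner_scale vector_smult_assoc) (simp flip: of_real_mult)
  have adj: "hinner x (a *v y) = hinner (a *v x) y" for x y
    using hinner_mstar[of a x y] positive_op_hermitian[OF a] by simp
  have pos: "hinner ((a - rank_one v) *v x) x \<in> \<real>\<^sub>\<ge>\<^sub>0" for x
  proof -
    let ?e = "axis i 1"
    define s where "s = hinner (a *v x) ?e / of_real d"
    have e: "hinner (a *v ?e) ?e = of_real d"
      by (simp add: hinner_axis d)
    have s: "hinner (a *v x) ?e = s * of_real d" "hinner (a *v ?e) x = cnj s * of_real d"
      using d by (simp_all add: s_def) (metis adj cnj_hinner)
    have "hinner (a *v (x - s *s ?e)) (x - s *s ?e)
        = hinner (a *v x) x - cnj s * hinner (a *v x) ?e - s * hinner (a *v ?e) x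
          + s * cnj s * hinner (a *v ?e) ?e"
      by (simp add: matrix_vector_mult_diff_distrib matrix_scale_apply hinner_diff hinner_scale algebra_simps)
    also have "\<dots> = hinner (a *v x) x - s * cnj s * of_real d"
      by (simp add: s e algebra_simps)
    also have "\<dots> = hinner ((a - rank_one v) *v x) x"
      by (simp add: matrix_vector_mult_diff_rdistrib v hinner_diff hinner_scale adj s[symmetric] s_def[symmetric])
    finally show ?thesis
      using a unfolding positive_op_def by metis
  qed
  then show p: "positive_op (a - rank_one v)"
    by (simp add: positive_op_def)
  show "(a - rank_one v) $ i $ i = 0"
    using d unfolding hinner_axis[symmetric]
    by (simp add: matrix_vector_mult_diff_rdistrib v hinner_diff hinner_scale adj hinner_axis)
  assume j: "a $ j $ j = 0"
  then have "a *v axis j 1 = 0"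
    using positive_op_kernel[OF a] by (simp add: hinner_axis)
  then show "(a - rank_one v) $ j $ j = 0"
    unfolding hinner_axis[symmetric]
    by (simp add: matrix_vector_mult_diff_rdistrib v hinner_diff hinner_scale adj)
qed

lemma trace_mult_positive_ops:
  assumes "positive_op a" "positive_op b"
  shows "trace (b ** a) \<in> \<real>\<^sub>\<ge>\<^sub>0"
  using assms(1)
proof (induction "card {i. a $ i $ i \<noteq> 0}" arbitrary: a rule: less_induct)
  case less
  show ?case
  proof (cases "\<exists>i. a $ i $ i \<noteq> 0")
    case False
    then have "a = 0"
      by (intro positive_op_trace_eq_0 less.prems) (simp add: trace_def)
    then show ?thesis by (simp add: trace_def)
  next
    case True
    then obtain i where i: "a $ i $ i \<noteq> 0" by blast
    define v where "v = of_real (1 / sqrt (Re (a $ i $ i))) *s (a *v axis i 1)"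
    note step = positive_op_Cholesky_step[OF less.prems i, folded v_def]
    have "{j. (a - rank_one v) $ j $ j \<noteq> 0} \<subset> {j. a $ j $ j \<noteq> 0}"
      using step(2,3) i by blast
    then have "card {j. (a - rank_one v) $ j $ j \<noteq> 0} < card {j. a $ j $ j \<noteq> 0}"
      by (intro psubset_card_mono) auto
    then have "trace (b ** (a - rank_one v)) \<in> \<real>\<^sub>\<ge>\<^sub>0"
      using less.hyps step(1) by blast
    moreover have "trace (b ** rank_one v) \<in> \<real>\<^sub>\<ge>\<^sub>0"
      using assms(2) by (simp add: trace_mult_rank_one positive_op_def)
    ultimately show ?thesis
      using nonneg_Reals_add_I by (fastforce simp: mult_diff trace_sub)
  qed
qed

lemma cstar_closed:
  assumes "unital_cstar_algebra B"
  shows "mat 1 \<in> B" "a \<in> B \<Longrightarrow> b \<in> B \<Longrightarrow> a + b \<in> B" "a \<in> B \<Longrightarrow> b \<in> B \<Longrightarrow> a ** b \<in> B"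
    "a \<in> B \<Longrightarrow> mscale c a \<in> B" "a \<in> B \<Longrightarrow> mstar a \<in> B" "a \<in> B \<Longrightarrow> b \<in> B \<Longrightarrow> a - b \<in> B"
    "0 \<in> B" "a \<in> B \<Longrightarrow> r *\<^sub>R a \<in> B"
proof -
  show *: "mat 1 \<in> B" "a \<in> B \<Longrightarrow> b \<in> B \<Longrightarrow> a + b \<in> B" "a \<in> B \<Longrightarrow> b \<in> B \<Longrightarrow> a ** b \<in> B"
    "a \<in> B \<Longrightarrow> mscale c a \<in> B" "a \<in> B \<Longrightarrow> mstar a \<in> B" for a b c
    using assms by (auto simp: unital_cstar_algebra_def)
  show "a \<in> B \<Longrightarrow> b \<in> B \<Longrightarrow> a - b \<in> B"
    using *(2)[of a "- b"] *(4)[of b "- 1"] by (simp flip: uminus_mscale)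
  show "0 \<in> B" using *(4)[of "mat 1" 0] *(1) by simp
  show "a \<in> B \<Longrightarrow> r *\<^sub>R a \<in> B" by (simp add: scaleR_mscale *)
qed

lemma cstar_subspace: "unital_cstar_algebra B \<Longrightarrow> subspace B"
  by (auto simp: subspace_def intro: cstar_closed)

lemma trace_mstar: "trace (mstar a) = cnj (trace a)"
  by (simp add: trace_def)

section \<open>Testing positivity on the algebra itself\<close>

lemma self_adjoint_of_trace_form:
  assumes D: "unital_cstar_algebra D" and Y: "Y \<in> D"
    and tr: "\<And>q. q \<in> D \<Longrightarrow> trace (mstar q ** Y ** q) \<in> \<real>\<^sub>\<ge>\<^sub>0"
  shows "mstar Y = Y"
proof -
  note [intro] = cstar_closed[OF D]
  define W where "W = mscale \<i> (Y - mstar Y)"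
  have W: "W \<in> D" "mstar W = W"
    using Y by (auto simp: W_def mstar_mscale mstar_diff vec_eq_iff algebra_simps)
  have *: "trace (W ** (q ** mstar q)) = 0" if "q \<in> D" for q
  proof -
    have "trace (mstar q ** mstar Y ** q) = cnj (trace (mstar q ** Y ** q))"
      by (simp add: trace_mstar[symmetric] mstar_mult matrix_mul_assoc)
    also have "\<dots> = trace (mstar q ** Y ** q)"
      using tr[OF that] by (simp add: complex_nonneg_Reals_iff complex_eq_iff)
    finally have "trace (mstar q ** (Y - mstar Y) ** q) = 0"
      by (simp add: mult_diff trace_sub)
    then have "trace ((Y - mstar Y) ** (q ** mstar q)) = 0"
      by (metis trace_mul_sym matrix_mul_assoc)
    then show ?thesis by (simp add: W_def mscale_mult trace_mscale)
  qed
  \<comment> \<open>Polarisation: comparing \<open>q = 1\<close>, \<open>q = W\<close> and \<open>q = 1 + W\<close> isolates \<open>tr W\<^sup>2\<close>.\<close>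
  have "trace W = 0" "trace (W ** (W ** W)) = 0" "trace (W ** ((mat 1 + W) ** (mat 1 + W))) = 0"
    using *[of "mat 1"] *[of W] *[of "mat 1 + W"] W D by (auto simp: mstar_add)
  moreover have "trace (W ** ((mat 1 + W) ** (mat 1 + W)))
      = trace W + (trace (W ** W) + (trace (W ** W) + trace (W ** (W ** W))))"
    by (simp only: mult_add trace_add matrix_mul_lid matrix_mul_rid ac_simps)
  ultimately have "trace (W ** mstar W) = 0"
    by (simp add: W)
  then have "W = 0" by (simp add: trace_mult_mstar_eq_0)
  then have "mscale (- \<i>) W = 0" by simp
  then show ?thesis by (simp add: W_def)
qed

text \<open>
  The algebra \<open>D\<close> with its trace form is a faithful representation space of \<open>D\<close>, so positivity of
  \<open>Y\<close> can be tested on \<open>D\<close> instead of on vectors. If the smallest eigenvalue \<open>l\<close> of \<open>Y\<close> were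
  negative, then left multiplication by \<open>Y - l\<close> would be injective on \<open>D\<close>, hence surjective for
  dimension reasons, and \<open>Y - l\<close> would have a right inverse.
\<close>

lemma positive_op_of_trace_form:
  fixes Y :: "complex^'n^'n"
  assumes D: "unital_cstar_algebra D" and Y: "Y \<in> D"
    and tr: "\<And>q. q \<in> D \<Longrightarrow> trace (mstar q ** Y ** q) \<in> \<real>\<^sub>\<ge>\<^sub>0"
  shows "positive_op Y"
proof -
  note [intro] = cstar_closed[OF D]
  have Yh: "mstar Y = Y" by (rule self_adjoint_of_trace_form[OF assms])
  define g where "g x = Re (hinner (Y *v x) x)" for x
  have real: "hinner (Y *v x) x = of_real (g x)" for x
    using cnj_hinner[of "Y *v x" x] hinner_mstar[of Y x x] Yh
    by (simp add: g_def complex_eq_iff)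
  have "continuous_on (sphere 0 1) g"
    unfolding g_def hinner_def matrix_vector_mult_def by (auto intro!: continuous_intros)
  moreover have "axis undefined 1 \<in> sphere (0 :: complex^'n) 1"
    by simp
  ultimately obtain x0 where x0: "x0 \<in> sphere 0 1" "\<And>x. x \<in> sphere 0 1 \<Longrightarrow> g x0 \<le> g x"
    using continuous_attains_inf[of "sphere 0 1" g] compact_sphere by (metis empty_iff)
  define l where "l = g x0"
  have bound: "l * (norm x)\<^sup>2 \<le> g x" for x
  proof (cases "x = 0")
    case False
    define u where "u = (1 / norm x) *\<^sub>R x"
    have "x = of_real (norm x) *s u"
      using False by (simp add: u_def vec_eq_iff scaleR_conv_of_real[where 'a = complex])
    then have "g x = (norm x)\<^sup>2 * g u"
      unfolding g_def by (metis (no_types, lifting) Re_complex_of_real complex_cnj_complex_of_real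
          hinner_scale matrix_scale_apply mult.assoc of_real_mult power2_eq_square real)
    moreover have "l \<le> g u"
      unfolding l_def using False by (intro x0) (simp add: u_def)
    ultimately show ?thesis
      by (simp add: mult.commute mult_right_mono)
  qed (simp add: g_def)
  have "0 \<le> l"
  proof (rule ccontr)
    assume neg: "\<not> 0 \<le> l"
    define T where "T = Y - mscale (of_real l) (mat 1)"
    have T: "T \<in> D" using Y by (auto simp: T_def)
    have Tx: "hinner (T *v x) x = of_real (g x - l * (norm x)\<^sup>2)" for x
      by (simp add: T_def matrix_vector_mult_diff_rdistrib mscale_apply hinner_diff hinner_scale real hinner_self)
    have "positive_op T"
      using bound by (simp add: positive_op_def Tx complex_nonneg_Reals_iff)
    moreover have "hinner (T *v x0) x0 = 0"
      using x0(1) by (simp add: Tx l_def)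
    ultimately have Tx0: "T *v x0 = 0" by (rule positive_op_kernel)
    have lin: "linear ((**) T :: complex^'n^'n \<Rightarrow> complex^'n^'n)"
      by (rule linearI) (simp_all add: mult_add mult_scaleR)
    have "q = 0" if q: "q \<in> D" "T ** q = 0" for q
    proof -
      have "Y ** q = mscale (of_real l) q"
        using q(2) by (simp add: T_def mult_diff mscale_mult)
      then have "trace (mstar q ** Y ** q) = of_real l * trace (mstar q ** q)"
        by (simp flip: matrix_mul_assoc add: mscale_mult trace_mscale)
      also have "trace (mstar q ** q) = of_real ((norm q)\<^sup>2)"
        by (metis trace_mul_sym trace_mult_mstar)
      finally have "0 \<le> l * (norm q)\<^sup>2"
        using tr[OF q(1)] by (simp add: complex_nonneg_Reals_iff)
      then have "(norm q)\<^sup>2 = 0"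
        using neg by (metis antisym_conv2 mult_neg_pos not_le zero_less_power2 power_zero_numeral zero_le_power2 less_le)
      then show ?thesis by simp
    qed
    then have "inj_on ((**) T) (span D)"
      using cstar_subspace[OF D]
      by (subst linear_injective_on_subspace_0[OF lin]) (auto simp: span_eq_iff[THEN iffD2])
    then have "dim ((**) T ` D) = dim D"
      by (rule dim_image_eq[OF lin])
    moreover have "subspace ((**) T ` D)" "(**) T ` D \<subseteq> D"
      using T lin cstar_subspace[OF D] by (auto intro: linear_subspace_image)
    ultimately have "(**) T ` D = D"
      using cstar_subspace[OF D] by (intro subspace_dim_equal) auto
    then obtain q where "T ** q = mat 1"
      using cstar_closed(1)[OF D] by force
    then have "q ** T = mat 1" by (simp add: matrix_left_right_inverse)
    then have "x0 = 0"
      using Tx0 by (metis matrix_vector_mul_assoc matrix_vector_mul_lid matrix_vector_mult_0_right)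
    then show False using x0(1) by simp
  qed
  then have "0 \<le> g x" for x
    using bound[of x] by (meson mult_nonneg_nonneg order_trans zero_le_power2)
  then show ?thesis
    by (simp add: positive_op_def real complex_nonneg_Reals_iff)
qed

section \<open>The trace preserving conditional expectation\<close>

text \<open>
  The trace orthogonal projection onto a *-algebra. The characterisation by the complex valued
  trace form makes complex linearity and the adjunction with the trace immediate from uniqueness.
\<close>

definition cond_exp :: "(complex^'n^'n) set \<Rightarrow> complex^'n^'n \<Rightarrow> complex^'n^'n" where
  "cond_exp C x = (SOME y. y \<in> C \<and> (\<forall>c\<in>C. trace ((x - y) ** c) = 0))"

lemma cond_exp_ex:
  assumes C: "unital_cstar_algebra C"
  shows "\<exists>y. y \<in> C \<and> (\<forall>c\<in>C. trace ((x - y) ** c) = 0)"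
proof -
  have span: "span C = C" using cstar_subspace[OF C] by (simp add: span_eq_iff)
  obtain y z where y: "y \<in> C" "\<And>w. w \<in> C \<Longrightarrow> orthogonal z w" "x = y + z"
    using orthogonal_subspace_decomp_exists[of C x] unfolding span by metis
  have "trace ((x - y) ** c) = 0" if c: "c \<in> C" for c
  proof -
    have *: "Re (trace (z ** w)) = 0" if "w \<in> C" for w
      using y(2)[of "mstar w"] cstar_closed[OF C] that by (simp add: orthogonal_def inner_eq_Re_trace)
    have "Re (trace (z ** c)) = 0" "Re (trace (z ** mscale \<i> c)) = 0"
      using c cstar_closed[OF C] by (auto intro!: *)
    then show ?thesis
      by (simp add: y mscale_mult trace_mscale complex_eq_iff)
  qed
  then show ?thesis using y by blast
qed

lemma cond_exp_in: "unital_cstar_algebra C \<Longrightarrow> cond_exp C x \<in> C"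
  unfolding cond_exp_def by (rule someI2_ex[OF cond_exp_ex]) auto

lemma trace_cond_exp:
  assumes C: "unital_cstar_algebra C" and c: "c \<in> C"
  shows "trace (cond_exp C x ** c) = trace (x ** c)"
proof -
  have "trace ((x - cond_exp C x) ** c) = 0"
    using someI_ex[OF cond_exp_ex[OF C], of x] c unfolding cond_exp_def by blast
  then show ?thesis by (simp add: mult_diff trace_sub)
qed

lemma cond_exp_unique:
  assumes C: "unital_cstar_algebra C" and y: "y \<in> C" "\<And>c. c \<in> C \<Longrightarrow> trace (y ** c) = trace (x ** c)"
  shows "cond_exp C x = y"
proof -
  define z where "z = cond_exp C x - y"
  have z: "z \<in> C" by (simp add: z_def cstar_closed[OF C] cond_exp_in[OF C] y)
  have "trace (z ** mstar z) = 0"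
    using trace_cond_exp[OF C cstar_closed(5)[OF C z]] y(2)[OF cstar_closed(5)[OF C z]]
    by (subst z_def) (simp add: mult_diff trace_sub)
  then show ?thesis by (simp add: trace_mult_mstar_eq_0 z_def)
qed

lemma cond_exp_add: "unital_cstar_algebra C \<Longrightarrow> cond_exp C (x + y) = cond_exp C x + cond_exp C y"
  by (rule cond_exp_unique) (simp_all add: cstar_closed cond_exp_in mult_add trace_add trace_cond_exp)

lemma cond_exp_mscale: "unital_cstar_algebra C \<Longrightarrow> cond_exp C (mscale k x) = mscale k (cond_exp C x)"
  by (rule cond_exp_unique) (simp_all add: cstar_closed cond_exp_in mscale_mult trace_mscale trace_cond_exp)

lemma cond_exp_id: "unital_cstar_algebra C \<Longrightarrow> c \<in> C \<Longrightarrow> cond_exp C c = c"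
  by (rule cond_exp_unique) simp_all

lemma trace_cond_exp_swap:
  assumes C: "unital_cstar_algebra C"
  shows "trace (d ** cond_exp C x) = trace (cond_exp C d ** x)"
  by (metis C cond_exp_in trace_cond_exp trace_mul_sym)

section \<open>Multiplicative domains of 2-positive and 2-copositive maps\<close>

lemma linear_map_onD:
  assumes "linear_map_on B \<psi>"
  shows "a \<in> B \<Longrightarrow> \<psi> a \<in> B" "a \<in> B \<Longrightarrow> b \<in> B \<Longrightarrow> \<psi> (a + b) = \<psi> a + \<psi> b"
    "a \<in> B \<Longrightarrow> \<psi> (mscale c a) = mscale c (\<psi> a)"
  using assms by (auto simp: linear_map_on_def)

lemma linear_map_on_diff:
  assumes "linear_map_on B \<psi>" "unital_cstar_algebra B" "a \<in> B" "b \<in> B"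
  shows "\<psi> (a - b) = \<psi> a - \<psi> b"
  using linear_map_onD[OF assms(1)] cstar_closed[OF assms(2)] assms(3,4)
  by (metis add_diff_cancel_right' diff_add_cancel)

text \<open>
  The quadratic form of the block matrix with rows \<open>(\<psi>(x\<^sup>*x), \<psi>(x\<^sup>*))\<close> and \<open>(\<psi>(x), \<psi>(1))\<close> at the
  vector \<open>(\<xi>, \<eta>)\<close>. Its positivity is Kadison's inequality for \<open>\<psi>\<close>. The product is a parameter \<open>mu\<close>
  so that the copositive case is the positive case for the opposite product.
\<close>

definition schwarz_form ::
    "(complex^'n^'n \<Rightarrow> complex^'n^'n \<Rightarrow> complex^'n^'n) \<Rightarrow> (complex^'n^'n \<Rightarrow> complex^'n^'n) \<Rightarrow>
     complex^'n^'n \<Rightarrow> complex^'n \<Rightarrow> complex^'n \<Rightarrow> complex" where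
  "schwarz_form mu \<psi> x \<xi> \<eta> =
     hinner (\<psi> (mu (mstar x) x) *v \<xi>) \<xi> + hinner (\<psi> (mstar x) *v \<eta>) \<xi> +
     hinner (\<psi> x *v \<xi>) \<eta> + hinner (\<psi> (mat 1) *v \<eta>) \<eta>"

definition schwarz_map where
  "schwarz_map mu B \<psi> \<longleftrightarrow> linear_map_on B \<psi> \<and> (\<forall>x\<in>B. \<forall>\<xi> \<eta>. schwarz_form mu \<psi> x \<xi> \<eta> \<in> \<real>\<^sub>\<ge>\<^sub>0)"

abbreviation (input) opp_mult :: "complex^'n^'n \<Rightarrow> complex^'n^'n \<Rightarrow> complex^'n^'n" where
  "opp_mult \<equiv> (\<lambda>a b. b ** a)"

lemma schwarz_map_linear: "schwarz_map mu B \<psi> \<Longrightarrow> linear_map_on B \<psi>"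
  by (simp add: schwarz_map_def)

lemma sum_lessThan_2: "(\<Sum>i<2. f i) = f 0 + f (1 :: nat)" for f :: "nat \<Rightarrow> 'a :: comm_monoid_add"
  by (simp add: numeral_2_eq_2)

lemma k_positive_2_schwarz:
  assumes B: "unital_cstar_algebra B" and \<psi>: "k_positive 2 B \<psi>"
  shows "schwarz_map (**) B \<psi>"
  unfolding schwarz_map_def
proof (intro conjI ballI allI)
  show "linear_map_on B \<psi>" using \<psi> by (simp add: k_positive_def)
  fix x and \<xi> \<eta> :: "complex^'a"
  assume x: "x \<in> B"
  define X where "X i j = (if i = 0 then if j = 0 then mstar x ** x else mstar x
     else if j = 0 then x else mat 1)" for i j :: nat
  have X: "X \<in> block_matrices 2 B"
    using cstar_closed[OF B] x by (auto simp: block_matrices_def X_def)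
  have "(\<Sum>i<2. hinner (\<Sum>j<2. X i j *v \<xi> j) (\<xi> i)) \<in> \<real>\<^sub>\<ge>\<^sub>0" for \<xi>
  proof -
    have "(\<Sum>i<2. hinner (\<Sum>j<2. X i j *v \<xi> j) (\<xi> i)) = hinner (x *v \<xi> 0 + \<xi> 1) (x *v \<xi> 0 + \<xi> 1)"
      by (simp add: sum_lessThan_2 X_def hinner_add hinner_mstar matrix_vector_mul_assoc[symmetric])
    then show ?thesis by (simp add: hinner_self_nonneg)
  qed
  then have "block_positive 2 (tensor_identity \<psi> X)"
    using \<psi> X by (auto simp: k_positive_def block_positive_def)
  from this[unfolded block_positive_def, rule_format, of "\<lambda>i. if i = 0 then \<xi> else \<eta>"]
  show "schwarz_form (**) \<psi> x \<xi> \<eta> \<in> \<real>\<^sub>\<ge>\<^sub>0"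
    by (simp add: sum_lessThan_2 tensor_identity_def X_def schwarz_form_def hinner_add ac_simps)
qed

lemma k_copositive_2_schwarz:
  assumes B: "unital_cstar_algebra B" and \<psi>: "k_copositive 2 B \<psi>"
  shows "schwarz_map opp_mult B \<psi>"
  unfolding schwarz_map_def
proof (intro conjI ballI allI)
  show "linear_map_on B \<psi>" using \<psi> by (simp add: k_copositive_def)
  fix x and \<xi> \<eta> :: "complex^'a"
  assume x: "x \<in> B"
  define X where "X i j = (if i = 0 then if j = 0 then x ** mstar x else x
     else if j = 0 then mstar x else mat 1)" for i j :: nat
  have X: "X \<in> block_matrices 2 B"
    using cstar_closed[OF B] x by (auto simp: block_matrices_def X_def)
  have "(\<Sum>i<2. hinner (\<Sum>j<2. X i j *v \<xi> j) (\<xi> i)) \<in> \<real>\<^sub>\<ge>\<^sub>0" for \<xi>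
  proof -
    have "(\<Sum>i<2. hinner (\<Sum>j<2. X i j *v \<xi> j) (\<xi> i))
        = hinner (mstar x *v \<xi> 0 + \<xi> 1) (mstar x *v \<xi> 0 + \<xi> 1)"
      using hinner_mstar[of "mstar x"]
      by (simp add: sum_lessThan_2 X_def hinner_add matrix_vector_mul_assoc[symmetric])
    then show ?thesis by (simp add: hinner_self_nonneg)
  qed
  then have "block_positive 2 (tensor_transpose \<psi> X)"
    using \<psi> X by (auto simp: k_copositive_def block_positive_def)
  from this[unfolded block_positive_def, rule_format, of "\<lambda>i. if i = 0 then \<xi> else \<eta>"]
  show "schwarz_form opp_mult \<psi> x \<xi> \<eta> \<in> \<real>\<^sub>\<ge>\<^sub>0"
    by (simp add: sum_lessThan_2 tensor_transpose_def X_def schwarz_form_def hinner_add ac_simps)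
qed

lemma schwarz_map_positive_op:
  assumes "schwarz_map mu B \<psi>" "x \<in> B"
  shows "positive_op (\<psi> (mu (mstar x) x))"
  unfolding positive_op_def
proof
  fix \<xi>
  have "schwarz_form mu \<psi> x \<xi> 0 \<in> \<real>\<^sub>\<ge>\<^sub>0"
    using assms by (auto simp: schwarz_map_def)
  then show "hinner (\<psi> (mu (mstar x) x) *v \<xi>) \<xi> \<in> \<real>\<^sub>\<ge>\<^sub>0"
    by (simp add: schwarz_form_def)
qed

lemma schwarz_map_unit:
  assumes "schwarz_map mu B \<psi>" "unital_cstar_algebra B"
  shows "positive_op (\<psi> (mat 1))"
  unfolding positive_op_def
proof
  fix \<eta>
  have "schwarz_form mu \<psi> (mat 1) 0 \<eta> \<in> \<real>\<^sub>\<ge>\<^sub>0"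
    using assms cstar_closed(1) by (auto simp: schwarz_map_def)
  then show "hinner (\<psi> (mat 1) *v \<eta>) \<eta> \<in> \<real>\<^sub>\<ge>\<^sub>0"
    by (simp add: schwarz_form_def)
qed

lemma schwarz_map_cross_terms:
  assumes S: "schwarz_map mu B \<psi>" and B: "unital_cstar_algebra B" and x: "x \<in> B"
  shows "hinner (\<psi> (mstar x) *v \<eta>) \<xi> = cnj (hinner (\<psi> x *v \<xi>) \<eta>)"
proof -
  define p q where "p = hinner (\<psi> (mstar x) *v \<eta>) \<xi>" and "q = hinner (\<psi> x *v \<xi>) \<eta>"
  have "schwarz_form mu \<psi> x \<xi> \<eta> \<in> \<real>\<^sub>\<ge>\<^sub>0" "schwarz_form mu \<psi> x \<xi> (\<i> *s \<eta>) \<in> \<real>\<^sub>\<ge>\<^sub>0"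
    "hinner (\<psi> (mu (mstar x) x) *v \<xi>) \<xi> \<in> \<real>\<^sub>\<ge>\<^sub>0" "hinner (\<psi> (mat 1) *v \<eta>) \<eta> \<in> \<real>\<^sub>\<ge>\<^sub>0"
    using S x schwarz_map_positive_op[OF S x] schwarz_map_unit[OF S B]
    by (auto simp: schwarz_map_def positive_op_def)
  then have "Im (p + q) = 0" "Im (\<i> * p - \<i> * q) = 0"
    by (auto simp: schwarz_form_def p_def q_def complex_nonneg_Reals_iff matrix_scale_apply hinner_scale)
  then have "p = cnj q" by (simp add: complex_eq_iff)
  then show ?thesis by (simp add: p_def q_def)
qed

lemma schwarz_map_mstar:
  assumes "schwarz_map mu B \<psi>" "unital_cstar_algebra B" "x \<in> B"
  shows "\<psi> (mstar x) = mstar (\<psi> x)"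
proof -
  have "\<psi> (mstar x) $ i $ j = cnj (\<psi> x $ j $ i)" for i j
    using schwarz_map_cross_terms[OF assms, of "axis j 1" "axis i 1"] by (simp only: hinner_axis)
  then show ?thesis by (simp add: vec_eq_iff)
qed

text \<open>
  Choi's multiplicative domain argument: if the form vanishes at \<open>(\<xi>, - a \<xi>)\<close> for every \<open>\<xi>\<close>, then
  perturbing \<open>a\<close> to \<open>a + t b\<close> in the first slot gives module identities for every \<open>b\<close>.
\<close>

lemma schwarz_equality_module:
  assumes B: "unital_cstar_algebra B" and mu: "mu = (**) \<or> mu = opp_mult"
    and S: "schwarz_map mu B \<psi>" and a: "a \<in> B" "mstar a = a"
    and eq: "\<And>\<xi>. schwarz_form mu \<psi> a \<xi> (- (a *v \<xi>)) = 0" and b: "b \<in> B"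
  shows "\<psi> (mu a b) = a ** \<psi> b" "\<psi> (mu b a) = \<psi> b ** a"
proof -
  note L = linear_map_onD[OF schwarz_map_linear[OF S]]
  note cl = cstar_closed[OF B]
  have mucl: "mu x y \<in> B" if "x \<in> B" "y \<in> B" for x y
    using mu that cl by auto
  have key: "hinner ((\<psi> (mu a b) - a ** \<psi> b) *v \<xi>) \<xi> = 0 \<and>
      hinner ((\<psi> (mu (mstar b) a) - \<psi> (mstar b) ** a) *v \<xi>) \<xi> = 0" if b: "b \<in> B" for b \<xi>
  proof -
    define u v N where "u = hinner ((\<psi> (mu a b) - a ** \<psi> b) *v \<xi>) \<xi>"
      and "v = hinner ((\<psi> (mu (mstar b) a) - \<psi> (mstar b) ** a) *v \<xi>) \<xi>"
      and "N = hinner (\<psi> (mu (mstar b) b) *v \<xi>) \<xi>"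
    have "t * u + cnj t * v + cnj t * t * N \<in> \<real>\<^sub>\<ge>\<^sub>0" for t
    proof -
      define x where "x = a + mscale t b"
      have x: "x \<in> B" "mstar x = a + mscale (cnj t) (mstar b)"
        using a b cl by (auto simp: x_def mstar_add mstar_mscale)
      have "mu (mstar x) x = mu a a + mscale t (mu a b) + mscale (cnj t) (mu (mstar b) a)
          + mscale (cnj t * t) (mu (mstar b) b)"
        unfolding x(2) using mu
        by (elim disjE) (simp_all add: x_def mult_add mscale_mult mscale_add ac_simps)
      then have "\<psi> (mu (mstar x) x) = \<psi> (mu a a) + mscale t (\<psi> (mu a b))
          + mscale (cnj t) (\<psi> (mu (mstar b) a)) + mscale (cnj t * t) (\<psi> (mu (mstar b) b))"
        using a b cl mucl by (simp add: L)
      moreover have "\<psi> (mstar x) = \<psi> a + mscale (cnj t) (\<psi> (mstar b))" "\<psi> x = \<psi> a + mscale t (\<psi> b)"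
        using a b cl unfolding x(2) by (simp_all add: x_def L)
      moreover have "hinner y (a *v \<xi>) = hinner (a *v y) \<xi>" for y
        using hinner_mstar[of a y \<xi>] a by simp
      ultimately have "schwarz_form mu \<psi> x \<xi> (- (a *v \<xi>))
          = schwarz_form mu \<psi> a \<xi> (- (a *v \<xi>)) + t * u + cnj t * v + cnj t * t * N"
        by (simp add: schwarz_form_def a u_def v_def N_def matrix_vector_mult_add_rdistrib
            matrix_vector_mult_diff_rdistrib mscale_apply hinner_add hinner_diff hinner_scale hinner_uminus
            matrix_uminus_apply matrix_vector_right_distrib matrix_scale_apply
            matrix_vector_mul_assoc[symmetric] algebra_simps)
      then show ?thesis
        using S x(1) by (simp add: eq schwarz_map_def) (metis add.assoc)
    qed
    then show ?thesis
      unfolding u_def[symmetric] v_def[symmetric] using first_order_vanishes by blast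
  qed
  show "\<psi> (mu a b) = a ** \<psi> b"
    using operator_eq_0[of "\<psi> (mu a b) - a ** \<psi> b"] key[OF b] by simp
  show "\<psi> (mu b a) = \<psi> b ** a"
    using operator_eq_0[of "\<psi> (mu b a) - \<psi> b ** a"] key[of "mstar b"] b cl by simp
qed

section \<open>Self-adjoint fixed points\<close>

lemma mprod_simps:
  "mprod [] = mat 1" "mprod (a # as) = a ** mprod as" "mprod (as @ [a]) = mprod as ** a"
  by (induction as) (simp_all add: mprod_def matrix_mul_assoc)

lemma mstar_mprod: "(\<And>a. a \<in> set as \<Longrightarrow> mstar a = a) \<Longrightarrow> mstar (mprod as) = mprod (rev as)"
  by (induction as) (simp_all add: mprod_simps mstar_mult)

text \<open>
  The two summands enter through Kadison's inequality, so that the same development serves the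
  given map, its powers, its averages and the invariant projection.
\<close>

locale schwarz_decomposition =
  fixes B :: "(complex^'n^'n) set" and \<phi> \<phi>1 \<phi>2 :: "complex^'n^'n \<Rightarrow> complex^'n^'n"
  assumes B: "unital_cstar_algebra B"
    and S1: "schwarz_map (**) B \<phi>1" and S2: "schwarz_map opp_mult B \<phi>2"
    and decomp: "a \<in> B \<Longrightarrow> \<phi> a = \<phi>1 a + \<phi>2 a"
    and unital: "\<phi> (mat 1) = mat 1"
    and trace_preserving: "a \<in> B \<Longrightarrow> trace (\<phi> a) = trace a"
begin

lemmas closed = cstar_closed[OF B]
lemmas L1 = linear_map_onD[OF schwarz_map_linear[OF S1]]
lemmas L2 = linear_map_onD[OF schwarz_map_linear[OF S2]]

lemma map_linear:
  shows "a \<in> B \<Longrightarrow> \<phi> a \<in> B" "a \<in> B \<Longrightarrow> b \<in> B \<Longrightarrow> \<phi> (a + b) = \<phi> a + \<phi> b"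
    "a \<in> B \<Longrightarrow> \<phi> (mscale c a) = mscale c (\<phi> a)" "a \<in> B \<Longrightarrow> \<phi> (mstar a) = mstar (\<phi> a)"
    "a \<in> B \<Longrightarrow> \<phi> (r *\<^sub>R a) = r *\<^sub>R \<phi> a"
  by (simp_all add: decomp closed L1 L2 mscale_add mstar_add schwarz_map_mstar[OF S1 B]
      schwarz_map_mstar[OF S2 B] scaleR_mscale)

lemma forms_sum:
  assumes a: "a \<in> B" "mstar a = a" "\<phi> a = a"
  shows "schwarz_form (**) \<phi>1 a \<xi> (- (a *v \<xi>)) + schwarz_form opp_mult \<phi>2 a \<xi> (- (a *v \<xi>))
    = hinner ((\<phi> (a ** a) - a ** a) *v \<xi>) \<xi>"
proof -
  have *: "hinner (\<phi>1 x *v y) z + hinner (\<phi>2 x *v y) z = hinner (\<phi> x *v y) z" if "x \<in> B" for x y z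
    using that by (simp add: decomp matrix_vector_mult_add_rdistrib hinner_add)
  have "hinner (a *v \<xi>) (a *v \<xi>) = hinner ((a ** a) *v \<xi>) \<xi>"
    using hinner_mstar[of a "a *v \<xi>" \<xi>] a by (simp add: matrix_vector_mul_assoc)
  then show ?thesis
    using *[of a \<xi> "a *v \<xi>"] *[of "a ** a" \<xi> \<xi>] *[of a "a *v \<xi>" \<xi>] *[of "mat 1" "a *v \<xi>" "a *v \<xi>"] a closed
    by (simp add: schwarz_form_def hinner_uminus matrix_uminus_apply matrix_vector_mult_diff_rdistrib
        hinner_diff unital matrix_vector_mul_assoc algebra_simps)
qed

text \<open>
  Kadison's inequality \<open>\<phi>(a\<^sup>2) \<ge> \<phi>(a)\<^sup>2 = a\<^sup>2\<close> is an equality on self-adjoint fixed points because both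
  sides have the same trace. The two nonnegative forms then vanish separately, which puts \<open>a\<close> in
  the multiplicative domains of both \<open>\<phi>1\<close> and \<open>\<phi>2\<close>.
\<close>

lemma fixed_self_adjoint_module:
  assumes a: "a \<in> B" "mstar a = a" "\<phi> a = a" and x: "x \<in> B"
  shows "\<phi>1 (a ** x) = a ** \<phi>1 x" "\<phi>1 (x ** a) = \<phi>1 x ** a"
    "\<phi>2 (a ** x) = \<phi>2 x ** a" "\<phi>2 (x ** a) = a ** \<phi>2 x"
proof -
  have nonneg: "schwarz_form (**) \<phi>1 a \<xi> \<eta> \<in> \<real>\<^sub>\<ge>\<^sub>0" "schwarz_form opp_mult \<phi>2 a \<xi> \<eta> \<in> \<real>\<^sub>\<ge>\<^sub>0" for \<xi> \<eta>
    using S1 S2 a by (auto simp: schwarz_map_def)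
  then have "positive_op (\<phi> (a ** a) - a ** a)"
    unfolding positive_op_def by (metis forms_sum[OF a] nonneg_Reals_add_I)
  moreover have "trace (\<phi> (a ** a) - a ** a) = 0"
    by (simp add: trace_sub trace_preserving closed a)
  ultimately have "\<phi> (a ** a) - a ** a = 0"
    by (rule positive_op_trace_eq_0)
  then have "schwarz_form (**) \<phi>1 a \<xi> (- (a *v \<xi>)) + schwarz_form opp_mult \<phi>2 a \<xi> (- (a *v \<xi>)) = 0" for \<xi>
    by (simp only: forms_sum[OF a] matrix_vector_mult_0 hinner_zero)
  then have "schwarz_form (**) \<phi>1 a \<xi> (- (a *v \<xi>)) = 0" "schwarz_form opp_mult \<phi>2 a \<xi> (- (a *v \<xi>)) = 0" for \<xi>
    using nonneg_complex_add_eq_0 nonneg by blast+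
  then show "\<phi>1 (a ** x) = a ** \<phi>1 x" "\<phi>1 (x ** a) = \<phi>1 x ** a"
    "\<phi>2 (a ** x) = \<phi>2 x ** a" "\<phi>2 (x ** a) = a ** \<phi>2 x"
    using schwarz_equality_module[OF B _ S1 a(1,2) _ x] schwarz_equality_module[OF B _ S2 a(1,2) _ x]
    by simp_all
qed

section \<open>Reversibility\<close>

lemma maps_on_words:
  assumes "set as \<subseteq> self_adjoint_part (fixed_points B \<phi>)"
  shows "mprod as \<in> B" "\<phi>1 (mprod as) = mprod as ** \<phi>1 (mat 1)"
    "\<phi>2 (mprod as) = \<phi>2 (mat 1) ** mprod (rev as)"
proof -
  have "mprod as \<in> B \<and> \<phi>1 (mprod as) = mprod as ** \<phi>1 (mat 1) \<and>
    \<phi>2 (mprod as) = \<phi>2 (mat 1) ** mprod (rev as)"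
    using assms
  proof (induction as)
    case (Cons a as)
    then have a: "a \<in> B" "mstar a = a" "\<phi> a = a"
      by (auto simp: self_adjoint_part_def fixed_points_def)
    then show ?case
      using Cons fixed_self_adjoint_module[OF a] a closed by (simp add: mprod_simps matrix_mul_assoc)
  qed (simp add: mprod_simps closed)
  then show "mprod as \<in> B" "\<phi>1 (mprod as) = mprod as ** \<phi>1 (mat 1)"
    "\<phi>2 (mprod as) = \<phi>2 (mat 1) ** mprod (rev as)" by blast+
qed

text \<open>
  With \<open>h = \<phi>1(1)\<close> and \<open>k = \<phi>2(1)\<close> a word \<open>w\<close> in self-adjoint fixed points satisfies \<open>\<phi>1(w) = w h\<close>
  and \<open>\<phi>2(w) = w\<^sup>r k\<close>, where \<open>w\<^sup>r\<close> is the reversed word, so that \<open>\<phi>(w + w\<^sup>r) = (w + w\<^sup>r)(h + k)\<close>.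
\<close>

lemma reversible_fixed_points: "reversible (self_adjoint_part (fixed_points B \<phi>))"
  unfolding reversible_def
proof (intro allI impI)
  fix as
  assume as: "as \<noteq> [] \<and> set as \<subseteq> self_adjoint_part (fixed_points B \<phi>)"
  define h k where "h = \<phi>1 (mat 1)" and "k = \<phi>2 (mat 1)"
  have hk: "h + k = mat 1" using decomp[OF closed(1)] by (simp add: h_def k_def unital)
  have hk_mstar: "mstar h = h"
    using schwarz_map_mstar[OF S1 B closed(1)] by (simp add: h_def)
  have words_mstar: "mstar (mprod xs) = mprod (rev xs)"
    if "set xs \<subseteq> self_adjoint_part (fixed_points B \<phi>)" for xs
    using that by (intro mstar_mprod) (auto simp: self_adjoint_part_def)
  let ?w = "mprod as" and ?r = "mprod (rev as)"
  note w = maps_on_words[of as] and r = maps_on_words[of "rev as"]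
  have comm: "h ** ?r = ?r ** h"
  proof -
    have "mstar (\<phi>1 ?w) = \<phi>1 ?r"
      using schwarz_map_mstar[OF S1 B, of ?w] w as words_mstar by simp
    then show ?thesis
      using w r as words_mstar by (simp add: mstar_mult hk_mstar h_def[symmetric])
  qed
  have comm': "h ** ?w = ?w ** h"
  proof -
    have "mstar (h ** ?r) = mstar (?r ** h)" by (simp add: comm)
    then show ?thesis
      using as words_mstar[of "rev as"] by (simp add: mstar_mult hk_mstar)
  qed
  have "\<phi> (?w + ?r) = h ** (?w + ?r) + k ** (?w + ?r)"
    using w r as closed by (simp add: decomp L1 L2 mult_add comm comm' h_def[symmetric] k_def[symmetric])
  also have "\<dots> = ?w + ?r"
    by (simp add: mult_add(2)[symmetric] hk)
  finally show "?w + ?r \<in> self_adjoint_part (fixed_points B \<phi>)"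
    using w r as closed words_mstar[of as] words_mstar[of "rev as"]
    by (simp add: self_adjoint_part_def fixed_points_def mstar_add add.commute)
qed

lemma jordan_fixed_points: "jordan_subalgebra B (self_adjoint_part (fixed_points B \<phi>))"
proof -
  let ?A = "self_adjoint_part (fixed_points B \<phi>)"
  have sub: "subspace ?A"
    using map_linear(5)[of 0 0] closed
    by (auto simp: subspace_def self_adjoint_part_def fixed_points_def map_linear mstar_add mstar_scaleR)
  have "jordan_product a b \<in> ?A" if "a \<in> ?A" "b \<in> ?A" for a b
  proof -
    have "mprod [a, b] + mprod (rev [a, b]) \<in> ?A"
      using reversible_fixed_points that unfolding reversible_def by (metis empty_subsetI insert_subset
          list.distinct(1) list.simps(15) set_empty)
    then have "a ** b + b ** a \<in> ?A" by (simp add: mprod_def)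
    then show ?thesis
      using sub unfolding jordan_product_def by (rule subspace_mul[rotated])
  qed
  then show ?thesis
    using sub by (auto simp: jordan_subalgebra_def self_adjoint_part_def fixed_points_def)
qed

section \<open>The common multiplicative domain\<close>

text \<open>
  On this algebra \<open>\<phi>1\<close> acts like multiplication by \<open>\<phi>1(1)\<close> and \<open>\<phi>2\<close> like a reversal \<open>c \<mapsto> d\<close>
  followed by multiplication by \<open>\<phi>2(1)\<close>. The reversal is stated as a relation since the reverse of
  an element is determined only up to the two-sided annihilator of \<open>\<phi>2(1)\<close>.
\<close>

definition module_domain :: "(complex^'n^'n) set" where
  "module_domain = {c \<in> B. (\<forall>x\<in>B. \<phi>1 (c ** x) = c ** \<phi>1 x \<and> \<phi>1 (x ** c) = \<phi>1 x ** c) \<and>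
     (\<exists>d\<in>B. \<forall>x\<in>B. \<phi>2 (c ** x) = \<phi>2 x ** d \<and> \<phi>2 (x ** c) = d ** \<phi>2 x)}"

lemma module_domainI:
  assumes "c \<in> B" "d \<in> B"
    and "\<And>x. x \<in> B \<Longrightarrow> \<phi>1 (c ** x) = c ** \<phi>1 x" "\<And>x. x \<in> B \<Longrightarrow> \<phi>1 (x ** c) = \<phi>1 x ** c"
    and "\<And>x. x \<in> B \<Longrightarrow> \<phi>2 (c ** x) = \<phi>2 x ** d" "\<And>x. x \<in> B \<Longrightarrow> \<phi>2 (x ** c) = d ** \<phi>2 x"
  shows "c \<in> module_domain"
  using assms by (auto simp: module_domain_def)

lemma module_domainE:
  assumes "c \<in> module_domain"
  obtains d where "c \<in> B" "d \<in> B"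
    "\<And>x. x \<in> B \<Longrightarrow> \<phi>1 (c ** x) = c ** \<phi>1 x" "\<And>x. x \<in> B \<Longrightarrow> \<phi>1 (x ** c) = \<phi>1 x ** c"
    "\<And>x. x \<in> B \<Longrightarrow> \<phi>2 (c ** x) = \<phi>2 x ** d" "\<And>x. x \<in> B \<Longrightarrow> \<phi>2 (x ** c) = d ** \<phi>2 x"
  using assms by (auto simp: module_domain_def)

lemma domain_module:
  "c \<in> module_domain \<Longrightarrow> x \<in> B \<Longrightarrow> \<phi>1 (c ** x) = c ** \<phi>1 x"
  "c \<in> module_domain \<Longrightarrow> x \<in> B \<Longrightarrow> \<phi>1 (x ** c) = \<phi>1 x ** c"
  by (auto simp: module_domain_def)

lemma module_domain_algebra: "unital_cstar_algebra module_domain"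
  unfolding unital_cstar_algebra_def
proof (intro conjI ballI allI)
  show "mat 1 \<in> module_domain"
    by (rule module_domainI[where d = "mat 1"]) (simp_all add: closed)
next
  fix c c' assume "c \<in> module_domain" "c' \<in> module_domain"
  then obtain d d' where c: "c \<in> B" "d \<in> B"
    "\<And>x. x \<in> B \<Longrightarrow> \<phi>1 (c ** x) = c ** \<phi>1 x" "\<And>x. x \<in> B \<Longrightarrow> \<phi>1 (x ** c) = \<phi>1 x ** c"
    "\<And>x. x \<in> B \<Longrightarrow> \<phi>2 (c ** x) = \<phi>2 x ** d" "\<And>x. x \<in> B \<Longrightarrow> \<phi>2 (x ** c) = d ** \<phi>2 x"
    and c': "c' \<in> B" "d' \<in> B"
    "\<And>x. x \<in> B \<Longrightarrow> \<phi>1 (c' ** x) = c' ** \<phi>1 x" "\<And>x. x \<in> B \<Longrightarrow> \<phi>1 (x ** c') = \<phi>1 x ** c'"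
    "\<And>x. x \<in> B \<Longrightarrow> \<phi>2 (c' ** x) = \<phi>2 x ** d'" "\<And>x. x \<in> B \<Longrightarrow> \<phi>2 (x ** c') = d' ** \<phi>2 x"
    by (elim module_domainE) blast
  show "c + c' \<in> module_domain"
    by (rule module_domainI[where d = "d + d'"]) (use c c' in \<open>simp_all add: closed mult_add L1 L2\<close>)
  show "c ** c' \<in> module_domain"
  proof (rule module_domainI[where d = "d' ** d"])
    fix x assume x: "x \<in> B"
    show "\<phi>1 (c ** c' ** x) = c ** c' ** \<phi>1 x" "\<phi>2 (c ** c' ** x) = \<phi>2 x ** (d' ** d)"
      using c(3,5)[of "c' ** x"] c'(1,3,5) x closed by (simp_all add: matrix_mul_assoc)
    show "\<phi>1 (x ** (c ** c')) = \<phi>1 x ** (c ** c')" "\<phi>2 (x ** (c ** c')) = d' ** d ** \<phi>2 x"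
      using c'(4,6)[of "x ** c"] c(1,4,6) x closed by (simp_all add: matrix_mul_assoc)
  qed (use c c' in \<open>simp_all add: closed\<close>)
next
  fix c k assume "c \<in> module_domain"
  then obtain d where c: "c \<in> B" "d \<in> B"
    "\<And>x. x \<in> B \<Longrightarrow> \<phi>1 (c ** x) = c ** \<phi>1 x" "\<And>x. x \<in> B \<Longrightarrow> \<phi>1 (x ** c) = \<phi>1 x ** c"
    "\<And>x. x \<in> B \<Longrightarrow> \<phi>2 (c ** x) = \<phi>2 x ** d" "\<And>x. x \<in> B \<Longrightarrow> \<phi>2 (x ** c) = d ** \<phi>2 x"
    by (elim module_domainE) blast
  show "mscale k c \<in> module_domain"
    by (rule module_domainI[where d = "mscale k d"]) (use c in \<open>simp_all add: closed mscale_mult L1 L2\<close>)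
next
  fix c assume "c \<in> module_domain"
  then obtain d where c: "c \<in> B" "d \<in> B"
    "\<And>x. x \<in> B \<Longrightarrow> \<phi>1 (c ** x) = c ** \<phi>1 x" "\<And>x. x \<in> B \<Longrightarrow> \<phi>1 (x ** c) = \<phi>1 x ** c"
    "\<And>x. x \<in> B \<Longrightarrow> \<phi>2 (c ** x) = \<phi>2 x ** d" "\<And>x. x \<in> B \<Longrightarrow> \<phi>2 (x ** c) = d ** \<phi>2 x"
    by (elim module_domainE) blast
  show "mstar c \<in> module_domain"
  proof (rule module_domainI[where d = "mstar d"])
    fix x assume x: "x \<in> B"
    have *: "mstar c ** x = mstar (mstar x ** c)" "x ** mstar c = mstar (c ** mstar x)"
      by (simp_all add: mstar_mult)
    have in_B: "mstar x ** c \<in> B" "c ** mstar x \<in> B" using c x closed by simp_all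
    note star1 = schwarz_map_mstar[OF S1 B] and star2 = schwarz_map_mstar[OF S2 B]
    show "\<phi>1 (mstar c ** x) = mstar c ** \<phi>1 x" "\<phi>1 (x ** mstar c) = \<phi>1 x ** mstar c"
      unfolding * star1[OF in_B(1)] star1[OF in_B(2)]
      using c x closed by (simp_all add: star1 mstar_mult)
    show "\<phi>2 (mstar c ** x) = \<phi>2 x ** mstar d" "\<phi>2 (x ** mstar c) = mstar d ** \<phi>2 x"
      unfolding * star2[OF in_B(1)] star2[OF in_B(2)]
      using c x closed by (simp_all add: star2 mstar_mult)
  qed (use c in \<open>simp_all add: closed\<close>)
qed

lemma fixed_self_adjoint_in_domain:
  "a \<in> B \<Longrightarrow> mstar a = a \<Longrightarrow> \<phi> a = a \<Longrightarrow> a \<in> module_domain"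
  by (rule module_domainI[where d = a]) (simp_all add: fixed_self_adjoint_module)

lemma module_domain_subset: "module_domain \<subseteq> B"
  by (auto simp: module_domain_def)

text \<open>A fixed point \<open>a\<close> is \<open>r + \<i> s\<close> with the self-adjoint fixed points \<open>r = (a + a\<^sup>*)/2\<close>, \<open>s = (a - a\<^sup>*)/(2\<i>)\<close>.\<close>

lemma fixed_points_cartesian:
  assumes a: "a \<in> B" "\<phi> a = a"
  obtains r s where "a = r + mscale \<i> s" "r \<in> B" "mstar r = r" "\<phi> r = r" "s \<in> B" "mstar s = s" "\<phi> s = s"
proof (rule that)
  let ?r = "mscale (1/2) (a + mstar a)" and ?s = "mscale (\<i>/2) (mstar a - a)"
  show "a = ?r + mscale \<i> ?s" "mstar ?r = ?r" "mstar ?s = ?s"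
    by (simp_all add: vec_eq_iff algebra_simps)
  have lin: "linear_map_on B \<phi>" using map_linear by (auto simp: linear_map_on_def)
  have "\<phi> (mstar a - a) = mstar a - a"
    using linear_map_on_diff[OF lin B, of "mstar a" a] a closed by (simp add: map_linear)
  then show "\<phi> ?s = ?s" "\<phi> ?r = ?r" using a closed by (simp_all add: map_linear)
  show "?r \<in> B" "?s \<in> B" using a closed by simp_all
qed

lemma fixed_in_domain: "a \<in> B \<Longrightarrow> \<phi> a = a \<Longrightarrow> a \<in> module_domain"
  by (erule (1) fixed_points_cartesian)
    (simp add: fixed_self_adjoint_in_domain cstar_closed[OF module_domain_algebra])

lemma trace_mult_fixed:
  assumes x: "x \<in> B" and a: "a \<in> B" "\<phi> a = a"
  shows "trace (\<phi> x ** a) = trace (x ** a)"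
proof -
  have *: "trace (\<phi> x ** a) = trace (x ** a)" if a: "a \<in> B" "mstar a = a" "\<phi> a = a" for a
  proof -
    have "trace (\<phi> x ** a) = trace (\<phi>1 x ** a) + trace (a ** \<phi>2 x)"
      by (simp add: decomp x mult_add trace_add trace_mul_sym[of "\<phi>2 x"])
    also have "\<dots> = trace (\<phi> (x ** a))"
      using x a closed by (simp add: decomp fixed_self_adjoint_module trace_add)
    also have "\<dots> = trace (x ** a)"
      using x a closed by (simp add: trace_preserving)
    finally show ?thesis .
  qed
  from fixed_points_cartesian[OF a] obtain r s where "a = r + mscale \<i> s"
    "r \<in> B" "mstar r = r" "\<phi> r = r" "s \<in> B" "mstar s = s" "\<phi> s = s" by blast
  then show ?thesis
    by (simp add: mult_add mscale_mult trace_add trace_mscale *)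
qed

text \<open>An idempotent \<open>\<phi>\<close> is the trace orthogonal projection onto its range, which lies in the algebra.\<close>

lemma idempotent_factors_through_cond_exp:
  assumes idem: "\<And>x. x \<in> B \<Longrightarrow> \<phi> (\<phi> x) = \<phi> x" and x: "x \<in> B"
  shows "\<phi> x = \<phi> (cond_exp module_domain x)"
proof -
  define e y where "e = cond_exp module_domain x" and "y = \<phi> (x - e)"
  have e: "e \<in> B"
    unfolding e_def using cond_exp_in[OF module_domain_algebra] module_domain_subset by blast
  have y: "y \<in> B" "\<phi> y = y"
    using x e closed map_linear idem by (simp_all add: y_def)
  then have ys: "mstar y \<in> B" "\<phi> (mstar y) = mstar y"
    using map_linear closed by simp_all
  have "trace (y ** mstar y) = trace ((x - e) ** mstar y)"
    using trace_mult_fixed[OF _ ys, of "x - e"] x e closed(6) unfolding y_def[symmetric] by blast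
  also have "\<dots> = 0"
    using trace_cond_exp[OF module_domain_algebra fixed_in_domain[OF ys], of x]
    by (simp add: mult_diff trace_sub e_def)
  finally have "y = 0" by (simp add: trace_mult_mstar_eq_0)
  moreover have "\<phi> x = \<phi> (x - e) + \<phi> e"
    using map_linear(2)[OF closed(6)[OF x e] e] by simp
  ultimately show ?thesis by (simp add: y_def e_def)
qed

end

section \<open>Complete positivity from positivity on a subalgebra\<close>

text \<open>
  Matrices with matrix entries are flattened to matrices indexed by pairs, so that positivity of a
  block matrix becomes positivity of an operator and \<open>M\<^sub>m(C)\<close> becomes another *-algebra.
\<close>

definition flat :: "('m::finite \<Rightarrow> 'm \<Rightarrow> complex^'n^'n) \<Rightarrow> complex^('m \<times> 'n)^('m \<times> 'n)" where
  "flat X = (\<chi> p q. X (fst p) (fst q) $ snd p $ snd q)"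

definition block_algebra :: "(complex^'n^'n) set \<Rightarrow> (complex^('m::finite \<times> 'n)^('m \<times> 'n)) set" where
  "block_algebra C = {flat X |X. \<forall>a b. X a b \<in> C}"

lemma sum_UNIV_prod: "(\<Sum>p\<in>UNIV. f p) = (\<Sum>a\<in>UNIV. \<Sum>i\<in>UNIV. f (a :: 'm::finite, i :: 'n::finite))"
  by (simp add: sum.cartesian_product flip: UNIV_Times_UNIV)

lemma sum_matrix_nth: "(\<Sum>i\<in>I. f i) $ a $ b = (\<Sum>i\<in>I. f i $ a $ b)"
  by (induction I rule: infinite_finite_induct) auto

lemma flat_add: "flat X + flat Y = flat (\<lambda>a b. X a b + Y a b)"
  by (simp add: vec_eq_iff flat_def)

lemma flat_mscale: "mscale c (flat X) = flat (\<lambda>a b. mscale c (X a b))"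
  by (simp add: vec_eq_iff flat_def)

lemma flat_mstar: "mstar (flat X) = flat (\<lambda>a b. mstar (X b a))"
  by (simp add: vec_eq_iff flat_def)

lemma flat_one: "flat (\<lambda>a b. if a = b then mat 1 else 0) = mat 1"
  by (simp add: vec_eq_iff flat_def mat_def)

lemma flat_mult:
  fixes X Y :: "'m::finite \<Rightarrow> 'm \<Rightarrow> complex^'n^'n"
  shows "flat X ** flat Y = flat (\<lambda>a b. \<Sum>c\<in>UNIV. X a c ** Y c b)"
  by (simp add: vec_eq_iff flat_def matrix_matrix_mult_def sum_UNIV_prod sum_matrix_nth)

lemma trace_flat: "trace (flat X) = (\<Sum>a\<in>UNIV. trace (X a a))"
  for X :: "'m::finite \<Rightarrow> 'm \<Rightarrow> complex^'n^'n"
  by (simp add: trace_def sum_UNIV_prod flat_def)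

lemma cstar_sum:
  "unital_cstar_algebra C \<Longrightarrow> (\<And>i. i \<in> I \<Longrightarrow> f i \<in> C) \<Longrightarrow> (\<Sum>i\<in>I. f i) \<in> C"
  by (intro subspace_sum cstar_subspace)

lemma trace_zero [simp]: "trace (0 :: complex^'n^'n) = 0"
  by (simp add: trace_def)

lemma trace_sum: "trace (\<Sum>i\<in>I. f i) = (\<Sum>i\<in>I. trace (f i :: complex^'n^'n))"
  by (induction I rule: infinite_finite_induct) (simp_all add: trace_add)

lemma block_algebraI: "(\<And>a b. X a b \<in> C) \<Longrightarrow> flat X \<in> block_algebra C"
  by (auto simp: block_algebra_def)

lemma block_algebraE:
  assumes "M \<in> block_algebra C"
  obtains X where "M = flat X" "\<And>a b. X a b \<in> C"
  using assms by (auto simp: block_algebra_def)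

lemma block_algebra_cstar:
  assumes C: "unital_cstar_algebra C"
  shows "unital_cstar_algebra (block_algebra C :: (complex^('m::finite \<times> 'n::finite)^('m \<times> 'n)) set)"
  unfolding unital_cstar_algebra_def
proof (intro conjI ballI allI)
  note closed = cstar_closed[OF C]
  have "flat (\<lambda>a b :: 'm. if a = b then mat 1 else 0) \<in> block_algebra C"
    by (intro block_algebraI) (simp add: closed(1,7))
  then show "mat 1 \<in> (block_algebra C :: (complex^('m \<times> 'n)^('m \<times> 'n)) set)"
    by (simp only: flat_one)
  fix M N :: "complex^('m \<times> 'n)^('m \<times> 'n)"
  assume M: "M \<in> block_algebra C"
  then obtain X where X: "M = flat X" "\<And>a b. X a b \<in> C" by (blast elim: block_algebraE)
  show "mstar M \<in> block_algebra C" "mscale c M \<in> block_algebra C" for c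
    unfolding X(1) flat_mstar flat_mscale by (intro block_algebraI closed X(2))+
  assume "N \<in> block_algebra C"
  then obtain Y where Y: "N = flat Y" "\<And>a b. Y a b \<in> C" by (blast elim: block_algebraE)
  show "M + N \<in> block_algebra C" "M ** N \<in> block_algebra C"
    unfolding X(1) Y(1) flat_add flat_mult
    by (intro block_algebraI cstar_sum[OF C] closed X(2) Y(2))+
qed

lemma functional_trace_density:
  assumes add: "\<And>x y. f (x + y) = f x + f y" and scale: "\<And>k x. f (mscale k x) = k * f x"
  shows "\<exists>d. \<forall>x :: complex^'n^'n. f x = trace (d ** x)"
proof -
  define e :: "'n \<Rightarrow> 'n \<Rightarrow> complex^'n^'n" where "e i j = (\<chi> a b. if a = i \<and> b = j then 1 else 0)" for i j
  have f0: "f 0 = 0" using scale[of 0 0] by simp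
  have fsum: "f (\<Sum>i\<in>I. g i) = (\<Sum>i\<in>I. f (g i))" for I and g :: "'n \<Rightarrow> complex^'n^'n"
    by (induction I rule: infinite_finite_induct) (simp_all add: f0 add)
  have "f x = trace ((\<chi> j i. f (e i j)) ** x)" for x
  proof -
    have "x $ a $ b = (\<Sum>i\<in>UNIV. \<Sum>j\<in>UNIV. mscale (x $ i $ j) (e i j)) $ a $ b" for a b
    proof -
      have "(\<Sum>i\<in>UNIV. \<Sum>j\<in>UNIV. mscale (x $ i $ j) (e i j)) $ a $ b
          = (\<Sum>i\<in>UNIV. \<Sum>j\<in>UNIV. if b = j then (if a = i then x $ i $ j else 0) else 0)"
        unfolding sum_matrix_nth by (intro sum.cong refl) (simp add: e_def)
      also have "\<dots> = x $ a $ b" by (simp add: sum.delta)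
      finally show ?thesis by (rule sym)
    qed
    then have "x = (\<Sum>i\<in>UNIV. \<Sum>j\<in>UNIV. mscale (x $ i $ j) (e i j))"
      by (intro vec_eq_iff[THEN iffD2] allI)
    then have "f x = f (\<Sum>i\<in>UNIV. \<Sum>j\<in>UNIV. mscale (x $ i $ j) (e i j))"
      by (rule arg_cong[where f = f])
    also have "\<dots> = (\<Sum>i\<in>UNIV. \<Sum>j\<in>UNIV. x $ i $ j * f (e i j))"
      by (simp add: fsum scale)
    also have "\<dots> = (\<Sum>j\<in>UNIV. \<Sum>i\<in>UNIV. x $ i $ j * f (e i j))"
      by (rule sum.swap)
    also have "\<dots> = trace ((\<chi> j i. f (e i j)) ** x)"
      by (simp add: trace_def matrix_matrix_mult_def mult.commute)
    finally show ?thesis .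
  qed
  then show ?thesis by (intro exI allI)
qed

text \<open>
  Trace duality. A matrix of functionals is given by a block matrix of densities, which lies in
  \<open>M\<^sub>m(C)\<close> because the functionals factor through the conditional expectation. Positivity on \<open>C\<close> says
  that the density has a nonnegative trace form on \<open>M\<^sub>m(C)\<close>, so it is a positive operator, and the
  trace of a product of positive operators is nonnegative.
\<close>

lemma functionals_positive_cond_exp:
  fixes g :: "'m::finite \<Rightarrow> 'm \<Rightarrow> complex^'n^'n \<Rightarrow> complex"
  assumes C: "unital_cstar_algebra C"
    and add: "\<And>a b x y. g a b (x + y) = g a b x + g a b y"
    and scale: "\<And>a b k x. g a b (mscale k x) = k * g a b x"
    and inv: "\<And>a b x. g a b (cond_exp C x) = g a b x"
    and pos: "\<And>p. (\<And>a. p a \<in> C) \<Longrightarrow> (\<Sum>a\<in>UNIV. \<Sum>b\<in>UNIV. g a b (p b ** mstar (p a))) \<in> \<real>\<^sub>\<ge>\<^sub>0"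
    and X: "positive_op (flat X)"
  shows "(\<Sum>a\<in>UNIV. \<Sum>b\<in>UNIV. g a b (X b a)) \<in> \<real>\<^sub>\<ge>\<^sub>0"
proof -
  have "\<forall>a b. \<exists>d. d \<in> C \<and> (\<forall>x. g a b x = trace (d ** x))"
  proof (intro allI)
    fix a b
    obtain d where d: "\<And>x. g a b x = trace (d ** x)"
      using functional_trace_density[of "g a b"] add scale by blast
    have "g a b x = trace (cond_exp C d ** x)" for x
      using d[of "cond_exp C x"] by (simp add: inv trace_cond_exp_swap[OF C])
    then show "\<exists>d. d \<in> C \<and> (\<forall>x. g a b x = trace (d ** x))"
      using cond_exp_in[OF C] by blast
  qed
  then obtain D where D: "\<And>a b. D a b \<in> C" "\<And>a b x. g a b x = trace (D a b ** x)"
    by metis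
  have "positive_op (flat D)"
  proof (rule positive_op_of_trace_form[OF block_algebra_cstar[OF C]])
    show "flat D \<in> block_algebra C" by (intro block_algebraI D(1))
    fix q :: "complex^('m \<times> 'n)^('m \<times> 'n)"
    assume "q \<in> block_algebra C"
    then obtain Q where Q: "q = flat Q" "\<And>a b. Q a b \<in> C" by (blast elim: block_algebraE)
    have "trace (mstar q ** flat D ** q) = trace (flat D ** (q ** mstar q))"
      by (metis matrix_mul_assoc trace_mul_sym)
    also have "\<dots> = (\<Sum>a\<in>UNIV. \<Sum>b\<in>UNIV. trace (D a b ** (\<Sum>l\<in>UNIV. Q b l ** mstar (Q a l))))"
      by (simp add: Q(1) flat_mstar flat_mult trace_flat trace_sum)
    also have "\<dots> = (\<Sum>a\<in>UNIV. \<Sum>b\<in>UNIV. \<Sum>l\<in>UNIV. g a b (Q b l ** mstar (Q a l)))"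
    proof -
      have "trace (d ** (\<Sum>l\<in>I. f l)) = (\<Sum>l\<in>I. trace (d ** f l))"
        for I and d :: "complex^'n^'n" and f :: "'m \<Rightarrow> complex^'n^'n"
        by (induction I rule: infinite_finite_induct) (simp_all add: mult_add trace_add)
      then show ?thesis by (simp add: D(2))
    qed
    also have "\<dots> = (\<Sum>a\<in>UNIV. \<Sum>l\<in>UNIV. \<Sum>b\<in>UNIV. g a b (Q b l ** mstar (Q a l)))"
      by (intro sum.cong refl sum.swap)
    also have "\<dots> = (\<Sum>l\<in>UNIV. \<Sum>a\<in>UNIV. \<Sum>b\<in>UNIV. g a b (Q b l ** mstar (Q a l)))"
      by (rule sum.swap)
    also have "\<dots> \<in> \<real>\<^sub>\<ge>\<^sub>0"
      by (intro nonneg_complex_sum pos Q)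
    finally show "trace (mstar q ** flat D ** q) \<in> \<real>\<^sub>\<ge>\<^sub>0" .
  qed
  then have "trace (flat D ** flat X) \<in> \<real>\<^sub>\<ge>\<^sub>0"
    by (rule trace_mult_positive_ops[OF X])
  then show ?thesis
    by (simp add: flat_mult trace_flat trace_sum D(2))
qed

text \<open>
  The vectors \<open>\<xi>\<^sub>i\<close> of \<open>\<complex>\<^sup>n\<close> compress a block matrix of arbitrary size to one indexed by the
  coordinates; this is why \<open>n\<close>-positivity of a map on \<open>n \<times> n\<close> matrices is complete positivity.
\<close>

definition compress ::
    "nat \<Rightarrow> (nat \<Rightarrow> complex^'n) \<Rightarrow> (nat \<Rightarrow> nat \<Rightarrow> complex^'n^'n) \<Rightarrow> 'n \<Rightarrow> 'n \<Rightarrow> complex^'n^'n" where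
  "compress k \<xi> X a b = (\<Sum>i<k. \<Sum>j<k. mscale (cnj (\<xi> i $ a) * \<xi> j $ b) (X i j))"

lemma sum_apply: "(\<Sum>i\<in>I. f i) *v x = (\<Sum>i\<in>I. (f i :: complex^'n^'m) *v x)"
  by (induction I rule: infinite_finite_induct) (simp_all add: matrix_vector_mult_add_rdistrib)

lemma apply_sum: "a *v (\<Sum>i\<in>I. f i) = (\<Sum>i\<in>I. (a :: complex^'n^'m) *v f i)"
  by (induction I rule: infinite_finite_induct) (simp_all add: matrix_vector_right_distrib)

lemma hinner_flat:
  fixes Z :: "'m::finite \<Rightarrow> 'm \<Rightarrow> complex^'n^'n"
  shows "hinner (flat Z *v v) v
    = (\<Sum>a\<in>UNIV. \<Sum>b\<in>UNIV. hinner (Z a b *v (\<chi> i. v $ (b, i))) (\<chi> i. v $ (a, i)))"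
proof -
  have "hinner (flat Z *v v) v = (\<Sum>a\<in>UNIV. \<Sum>i\<in>UNIV. \<Sum>b\<in>UNIV. \<Sum>j\<in>UNIV.
      Z a b $ i $ j * v $ (b, j) * cnj (v $ (a, i)))"
    by (simp add: hinner_def matrix_vector_mult_def sum_UNIV_prod flat_def sum_distrib_right)
  also have "\<dots> = (\<Sum>a\<in>UNIV. \<Sum>b\<in>UNIV. \<Sum>i\<in>UNIV. \<Sum>j\<in>UNIV.
      Z a b $ i $ j * v $ (b, j) * cnj (v $ (a, i)))"
    by (intro sum.cong refl sum.swap)
  finally show ?thesis
    by (simp add: hinner_def matrix_vector_mult_def sum_distrib_right)
qed

lemma sum_swap_pairs:
  "(\<Sum>a\<in>A. \<Sum>b\<in>A'. \<Sum>i\<in>I. \<Sum>j\<in>I'. f a b i j) = (\<Sum>i\<in>I. \<Sum>j\<in>I'. \<Sum>a\<in>A. \<Sum>b\<in>A'. f a b i j)"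
  for f :: "_ \<Rightarrow> _ \<Rightarrow> _ \<Rightarrow> _ \<Rightarrow> complex"
proof -
  have "(\<Sum>a\<in>A. \<Sum>b\<in>A'. \<Sum>i\<in>I. \<Sum>j\<in>I'. f a b i j) = (\<Sum>a\<in>A. \<Sum>i\<in>I. \<Sum>b\<in>A'. \<Sum>j\<in>I'. f a b i j)"
    by (intro sum.cong refl sum.swap)
  also have "\<dots> = (\<Sum>i\<in>I. \<Sum>a\<in>A. \<Sum>j\<in>I'. \<Sum>b\<in>A'. f a b i j)"
    by (subst sum.swap) (intro sum.cong refl sum.swap)
  also have "\<dots> = (\<Sum>i\<in>I. \<Sum>j\<in>I'. \<Sum>a\<in>A. \<Sum>b\<in>A'. f a b i j)"
    by (intro sum.cong refl sum.swap)
  finally show ?thesis .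
qed

lemma positive_op_compress:
  fixes X :: "nat \<Rightarrow> nat \<Rightarrow> complex^'n^'n"
  assumes "block_positive k X"
  shows "positive_op (flat (compress k \<xi> X))"
  unfolding positive_op_def
proof
  fix v :: "complex^('n \<times> 'n)"
  define w :: "'n \<Rightarrow> complex^'n" where "w a = (\<chi> i. v $ (a, i))" for a
  define \<eta> where "\<eta> j = (\<Sum>b\<in>UNIV. \<xi> j $ b *s w b)" for j
  have "hinner (flat (compress k \<xi> X) *v v) v
      = (\<Sum>a\<in>UNIV. \<Sum>b\<in>UNIV. \<Sum>i<k. \<Sum>j<k. cnj (\<xi> i $ a) * (\<xi> j $ b * hinner (X i j *v w b) (w a)))"
    by (simp add: hinner_flat compress_def w_def[symmetric] sum_apply hinner_sum mscale_apply hinner_scale mult.assoc)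
  also have "\<dots> = (\<Sum>i<k. \<Sum>j<k. \<Sum>a\<in>UNIV. \<Sum>b\<in>UNIV. cnj (\<xi> i $ a) * (\<xi> j $ b * hinner (X i j *v w b) (w a)))"
    by (rule sum_swap_pairs)
  also have "\<dots> = (\<Sum>i<k. \<Sum>a\<in>UNIV. \<Sum>j<k. \<Sum>b\<in>UNIV. cnj (\<xi> i $ a) * (\<xi> j $ b * hinner (X i j *v w b) (w a)))"
    by (intro sum.cong refl sum.swap)
  also have "\<dots> = (\<Sum>i<k. hinner (\<Sum>j<k. X i j *v \<eta> j) (\<eta> i))"
    by (simp add: \<eta>_def hinner_sum apply_sum matrix_scale_apply hinner_scale sum_distrib_left)
  also have "\<dots> \<in> \<real>\<^sub>\<ge>\<^sub>0"
    using assms by (simp add: block_positive_def)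
  finally show "hinner (flat (compress k \<xi> X) *v v) v \<in> \<real>\<^sub>\<ge>\<^sub>0" .
qed

lemma amplification_compress:
  fixes \<psi> :: "complex^'n^'n \<Rightarrow> complex^'n^'n"
  assumes add: "\<And>x y. \<psi> (x + y) = \<psi> x + \<psi> y" and scale: "\<And>c x. \<psi> (mscale c x) = mscale c (\<psi> x)"
  shows "(\<Sum>i<k. hinner (\<Sum>j<k. \<psi> (X i j) *v \<xi> j) (\<xi> i))
    = (\<Sum>a\<in>UNIV. \<Sum>b\<in>UNIV. \<psi> (compress k \<xi> X a b) $ a $ b)"
proof -
  have \<psi>0: "\<psi> 0 = 0" using scale[of 0 0] by simp
  have \<psi>sum: "\<psi> (\<Sum>i\<in>I. f i) = (\<Sum>i\<in>I. \<psi> (f i))" for I and f :: "nat \<Rightarrow> complex^'n^'n"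
    by (induction I rule: infinite_finite_induct) (simp_all add: \<psi>0 add)
  have "(\<Sum>i<k. hinner (\<Sum>j<k. \<psi> (X i j) *v \<xi> j) (\<xi> i))
      = (\<Sum>i<k. \<Sum>j<k. \<Sum>a\<in>UNIV. \<Sum>b\<in>UNIV. cnj (\<xi> i $ a) * \<xi> j $ b * \<psi> (X i j) $ a $ b)"
    by (simp add: hinner_sum(1)) (simp add: hinner_def matrix_vector_mult_def sum_distrib_right sum_distrib_left ac_simps)
  also have "\<dots> = (\<Sum>a\<in>UNIV. \<Sum>b\<in>UNIV. \<Sum>i<k. \<Sum>j<k. cnj (\<xi> i $ a) * \<xi> j $ b * \<psi> (X i j) $ a $ b)"
    by (rule sum_swap_pairs)
  also have "\<dots> = (\<Sum>a\<in>UNIV. \<Sum>b\<in>UNIV. \<psi> (compress k \<xi> X a b) $ a $ b)"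
    by (simp add: compress_def \<psi>sum scale sum_matrix_nth)
  finally show ?thesis .
qed

lemma compress_transpose: "compress k \<xi> (\<lambda>i j. X j i) a b = compress k (\<lambda>i. \<chi> a. cnj (\<xi> i $ a)) X b a"
  unfolding compress_def by (subst sum.swap) (simp add: mult.commute)

context schwarz_decomposition
begin

lemma cond_exp_domain: "cond_exp module_domain x \<in> module_domain" "cond_exp module_domain x \<in> B"
  using cond_exp_in[OF module_domain_algebra] module_domain_subset by blast+

lemma sum_sandwich: 
  assumes h: "positive_op h"
  shows "(\<Sum>a\<in>UNIV. \<Sum>b\<in>UNIV. (mstar (d a) ** h ** d b) $ a $ b) \<in> \<real>\<^sub>\<ge>\<^sub>0"
proof -
  let ?\<eta> = "\<Sum>b\<in>UNIV. d b *v axis b 1"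
  have "(mstar (d a) ** h ** d b) $ a $ b = hinner (h *v (d b *v axis b 1)) (d a *v axis a 1)" for a b
    by (simp add: hinner_axis[symmetric] hinner_mstar matrix_vector_mul_assoc[symmetric])
  then have "(\<Sum>a\<in>UNIV. \<Sum>b\<in>UNIV. (mstar (d a) ** h ** d b) $ a $ b) = hinner (h *v ?\<eta>) ?\<eta>"
    by (simp add: hinner_sum apply_sum)
  then show ?thesis using h by (simp add: positive_op_def)
qed

text \<open>
  For \<open>p\<^sub>a\<close> in the domain, \<open>\<phi>1(p\<^sub>b p\<^sub>a\<^sup>*) = p\<^sub>b \<phi>1(1) p\<^sub>a\<^sup>*\<close>, which has the factored form of a positive
  block matrix.
\<close>

lemma completely_positive_part: "completely_positive B (\<lambda>x. \<phi>1 (cond_exp module_domain x))"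
  unfolding completely_positive_def k_positive_def
proof (intro allI impI conjI ballI)
  let ?C = "module_domain"
  let ?\<psi> = "\<lambda>x. \<phi>1 (cond_exp ?C x)"
  note C = module_domain_algebra
  have add: "?\<psi> (x + y) = ?\<psi> x + ?\<psi> y" and scale: "?\<psi> (mscale c x) = mscale c (?\<psi> x)" for x y c
    by (simp_all add: cond_exp_add[OF C] cond_exp_mscale[OF C] L1 cond_exp_domain)
  show "linear_map_on B ?\<psi>"
    using add scale by (auto simp: linear_map_on_def L1 cond_exp_domain)
  fix k :: nat and X :: "nat \<Rightarrow> nat \<Rightarrow> complex^'n^'n"
  assume X: "block_positive k X"
  have "(\<Sum>i<k. hinner (\<Sum>j<k. ?\<psi> (X i j) *v \<xi> j) (\<xi> i)) \<in> \<real>\<^sub>\<ge>\<^sub>0" for \<xi>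
  proof -
    define g where "g a b x = ?\<psi> x $ b $ a" for a b x
    have "(\<Sum>a\<in>UNIV. \<Sum>b\<in>UNIV. g a b (compress k \<xi> X b a)) \<in> \<real>\<^sub>\<ge>\<^sub>0"
    proof (rule functionals_positive_cond_exp[OF C, where g = g and X = "compress k \<xi> X"])
      fix p :: "'n \<Rightarrow> complex^'n^'n"
      assume p: "\<And>a. p a \<in> ?C"
      have "?\<psi> (p b ** mstar (p a)) = p b ** \<phi>1 (mat 1) ** mstar (p a)" for a b
      proof -
        have star: "mstar (p a) \<in> ?C" "mstar (p a) \<in> B"
          using cstar_closed(5)[OF C p[of a]] module_domain_subset by auto
        have "\<phi>1 (p b ** mstar (p a)) = p b ** \<phi>1 (mstar (p a))"
          by (rule domain_module(1)[OF p star(2)])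
        also have "\<phi>1 (mstar (p a)) = \<phi>1 (mat 1) ** mstar (p a)"
          using domain_module(2)[OF star(1) closed(1)] by simp
        finally show ?thesis
          using p cstar_closed[OF C] by (simp add: cond_exp_id[OF C] matrix_mul_assoc)
      qed
      then have "(\<Sum>a\<in>UNIV. \<Sum>b\<in>UNIV. g a b (p b ** mstar (p a)))
          = (\<Sum>b\<in>UNIV. \<Sum>a\<in>UNIV. (mstar (mstar (p b)) ** \<phi>1 (mat 1) ** mstar (p a)) $ b $ a)"
        unfolding g_def by (subst sum.swap) simp
      also have "\<dots> \<in> \<real>\<^sub>\<ge>\<^sub>0"
        by (rule sum_sandwich[OF schwarz_map_unit[OF S1 B], where d = "\<lambda>b. mstar (p b)"])
      finally show "(\<Sum>a\<in>UNIV. \<Sum>b\<in>UNIV. g a b (p b ** mstar (p a))) \<in> \<real>\<^sub>\<ge>\<^sub>0" .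
    qed (rule positive_op_compress[OF X] | simp add: g_def add scale cond_exp_id[OF C cond_exp_domain(1)])+
    also have "(\<Sum>a\<in>UNIV. \<Sum>b\<in>UNIV. g a b (compress k \<xi> X b a))
        = (\<Sum>i<k. hinner (\<Sum>j<k. ?\<psi> (X i j) *v \<xi> j) (\<xi> i))"
      unfolding amplification_compress[of ?\<psi>, OF add scale] g_def by (rule sum.swap)
    finally show ?thesis .
  qed
  then show "block_positive k (tensor_identity ?\<psi> X)"
    by (simp add: block_positive_def tensor_identity_def)
qed

text \<open>
  If \<open>d\<^sub>a\<close> is a reverse of \<open>p\<^sub>a\<close>, then \<open>\<phi>2(p\<^sub>b p\<^sub>a\<^sup>*) = d\<^sub>a\<^sup>* \<phi>2(1) d\<^sub>b\<close>: the same factored form with the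
  indices \<open>a\<close> and \<open>b\<close> exchanged.
\<close>

lemma copositive_part: "copositive B (\<lambda>x. \<phi>2 (cond_exp module_domain x))"
  unfolding copositive_def k_copositive_def
proof (intro allI impI conjI ballI)
  let ?C = "module_domain"
  let ?\<psi> = "\<lambda>x. \<phi>2 (cond_exp ?C x)"
  note C = module_domain_algebra
  have add: "?\<psi> (x + y) = ?\<psi> x + ?\<psi> y" and scale: "?\<psi> (mscale c x) = mscale c (?\<psi> x)" for x y c
    by (simp_all add: cond_exp_add[OF C] cond_exp_mscale[OF C] L2 cond_exp_domain)
  show "linear_map_on B ?\<psi>"
    using add scale by (auto simp: linear_map_on_def L2 cond_exp_domain)
  fix k :: nat and X :: "nat \<Rightarrow> nat \<Rightarrow> complex^'n^'n"
  assume X: "block_positive k X"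
  have "(\<Sum>i<k. hinner (\<Sum>j<k. ?\<psi> (X j i) *v \<xi> j) (\<xi> i)) \<in> \<real>\<^sub>\<ge>\<^sub>0" for \<xi>
  proof -
    define \<zeta> where "\<zeta> i = (\<chi> a. cnj (\<xi> i $ a))" for i
    define g where "g a b x = ?\<psi> x $ a $ b" for a b x
    have "(\<Sum>a\<in>UNIV. \<Sum>b\<in>UNIV. g a b (compress k \<zeta> X b a)) \<in> \<real>\<^sub>\<ge>\<^sub>0"
    proof (rule functionals_positive_cond_exp[OF C, where g = g and X = "compress k \<zeta> X"])
      fix p :: "'n \<Rightarrow> complex^'n^'n"
      assume p: "\<And>a. p a \<in> ?C"
      have "\<forall>a. \<exists>d. \<forall>x\<in>B. \<phi>2 (p a ** x) = \<phi>2 x ** d"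
        using p unfolding module_domain_def by fast
      from choice[OF this] obtain d where "\<forall>a. \<forall>x\<in>B. \<phi>2 (p a ** x) = \<phi>2 x ** d a" ..
      then have d: "\<phi>2 (p a ** x) = \<phi>2 x ** d a" if "x \<in> B" for a x
        using that by simp
      have pB: "p a \<in> B" for a using p module_domain_subset by blast
      have "?\<psi> (p b ** mstar (p a)) = mstar (d a) ** \<phi>2 (mat 1) ** d b" for a b
      proof -
        have "\<phi>2 (mstar (p a)) = mstar (\<phi>2 (mat 1) ** d a)"
          using schwarz_map_mstar[OF S2 B pB[of a]] d[OF closed(1), of a] by simp
        also have "\<dots> = mstar (d a) ** \<phi>2 (mat 1)"
          using schwarz_map_mstar[OF S2 B closed(1)] by (simp add: mstar_mult)
        finally show ?thesis
          using d[of "mstar (p a)" b] pB closed p cstar_closed[OF C] by (simp add: cond_exp_id[OF C])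
      qed
      then show "(\<Sum>a\<in>UNIV. \<Sum>b\<in>UNIV. g a b (p b ** mstar (p a))) \<in> \<real>\<^sub>\<ge>\<^sub>0"
        unfolding g_def using sum_sandwich[OF schwarz_map_unit[OF S2 B], of d] by simp
    qed (rule positive_op_compress[OF X] | simp add: g_def add scale cond_exp_id[OF C cond_exp_domain(1)])+
    also have "(\<Sum>a\<in>UNIV. \<Sum>b\<in>UNIV. g a b (compress k \<zeta> X b a))
        = (\<Sum>i<k. hinner (\<Sum>j<k. ?\<psi> (X j i) *v \<xi> j) (\<xi> i))"
      unfolding amplification_compress[of ?\<psi>, OF add scale] g_def \<zeta>_def
        compress_transpose[of k \<xi> X] by (rule refl)
    finally show ?thesis .
  qed
  then show "block_positive k (tensor_transpose ?\<psi> X)"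
    by (simp add: block_positive_def tensor_transpose_def)
qed

text \<open>
  Composing both summands with the conditional expectation leaves an idempotent \<open>\<phi>\<close> unchanged and
  makes the summands completely positive and copositive.
\<close>

lemma idempotent_decomposable:
  assumes "positive_map B \<phi>" "\<And>x. x \<in> B \<Longrightarrow> \<phi> (\<phi> x) = \<phi> x"
  shows "decomposable B \<phi>"
proof -
  have "\<phi> a = \<phi>1 (cond_exp module_domain a) + \<phi>2 (cond_exp module_domain a)" if "a \<in> B" for a
    using idempotent_factors_through_cond_exp[OF assms(2) that] decomp[OF cond_exp_domain(2)] by simp
  then show ?thesis
    using assms(1) completely_positive_part copositive_part unfolding decomposable_def by blast
qed

end

section \<open>Averages of decomposable maps\<close>

lemma linear_map_on_comp:
  "linear_map_on B \<psi> \<Longrightarrow> linear_map_on B \<omega> \<Longrightarrow> linear_map_on B (\<lambda>x. \<psi> (\<omega> x))"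
  by (auto simp: linear_map_on_def image_subset_iff)

lemma linear_map_on_add:
  assumes "unital_cstar_algebra B" "linear_map_on B \<psi>" "linear_map_on B \<omega>"
  shows "linear_map_on B (\<lambda>x. \<psi> x + \<omega> x)"
  using assms by (auto simp: linear_map_on_def image_subset_iff mscale_add cstar_closed)

lemma linear_map_on_scaleR:
  assumes "unital_cstar_algebra B" "linear_map_on B \<psi>"
  shows "linear_map_on B (\<lambda>x. r *\<^sub>R \<psi> x)"
  using assms
  by (auto simp: linear_map_on_def image_subset_iff mscale_scaleR cstar_closed scaleR_add_right)

lemma block_positive_add:
  assumes "block_positive k X" "block_positive k Y"
  shows "block_positive k (\<lambda>i j. X i j + Y i j)"
  unfolding block_positive_def
proof
  fix \<xi>
  have "(\<Sum>i<k. hinner (\<Sum>j<k. X i j *v \<xi> j) (\<xi> i)) + (\<Sum>i<k. hinner (\<Sum>j<k. Y i j *v \<xi> j) (\<xi> i)) \<in> \<real>\<^sub>\<ge>\<^sub>0"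
    using assms by (intro nonneg_Reals_add_I) (auto simp: block_positive_def)
  then show "(\<Sum>i<k. hinner (\<Sum>j<k. (X i j + Y i j) *v \<xi> j) (\<xi> i)) \<in> \<real>\<^sub>\<ge>\<^sub>0"
    by (simp add: matrix_vector_mult_add_rdistrib sum.distrib hinner_add)
qed

lemma block_positive_scaleR:
  assumes "block_positive k X" "0 \<le> r"
  shows "block_positive k (\<lambda>i j. r *\<^sub>R X i j)"
  unfolding block_positive_def
proof
  fix \<xi>
  have "(\<Sum>i<k. hinner (\<Sum>j<k. (r *\<^sub>R X i j) *v \<xi> j) (\<xi> i))
      = of_real r * (\<Sum>i<k. hinner (\<Sum>j<k. X i j *v \<xi> j) (\<xi> i))"
    by (simp add: scaleR_mscale mscale_apply hinner_sum hinner_scale sum_distrib_left)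
  also have "\<dots> \<in> \<real>\<^sub>\<ge>\<^sub>0"
    using assms by (intro nonneg_Reals_mult_I) (auto simp: block_positive_def)
  finally show "(\<Sum>i<k. hinner (\<Sum>j<k. (r *\<^sub>R X i j) *v \<xi> j) (\<xi> i)) \<in> \<real>\<^sub>\<ge>\<^sub>0" .
qed

lemma block_positive_limit:
  assumes pos: "\<And>n. block_positive k (X n)"
    and lim: "\<And>i j. i < k \<Longrightarrow> j < k \<Longrightarrow> (\<lambda>n. X n i j) \<longlonglongrightarrow> Y i j"
  shows "block_positive k Y"
  unfolding block_positive_def
proof
  fix \<xi>
  show "(\<Sum>i<k. hinner (\<Sum>j<k. Y i j *v \<xi> j) (\<xi> i)) \<in> \<real>\<^sub>\<ge>\<^sub>0"
  proof (rule closed_sequentially[OF closed_nonneg_Reals_complex])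
    show "(\<Sum>i<k. hinner (\<Sum>j<k. X n i j *v \<xi> j) (\<xi> i)) \<in> \<real>\<^sub>\<ge>\<^sub>0" for n
      using pos[of n] by (simp add: block_positive_def)
    show "(\<lambda>n. \<Sum>i<k. hinner (\<Sum>j<k. X n i j *v \<xi> j) (\<xi> i))
        \<longlonglongrightarrow> (\<Sum>i<k. hinner (\<Sum>j<k. Y i j *v \<xi> j) (\<xi> i))"
      unfolding hinner_def matrix_vector_mult_def sum_component vec_lambda_beta
      by (intro tendsto_intros lim) auto
  qed
qed

definition splits ::
    "nat \<Rightarrow> (complex^'n^'n) set \<Rightarrow> (complex^'n^'n \<Rightarrow> complex^'n^'n) \<Rightarrow> (complex^'n^'n \<Rightarrow> complex^'n^'n) \<Rightarrow>
     (complex^'n^'n \<Rightarrow> complex^'n^'n) \<Rightarrow> bool" where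
  "splits k B \<omega> \<alpha> \<beta> \<longleftrightarrow> k_positive k B \<alpha> \<and> k_copositive k B \<beta> \<and> (\<forall>a\<in>B. \<omega> a = \<alpha> a + \<beta> a)"

lemma splits_linear:
  assumes "splits k B \<omega> \<alpha> \<beta>"
  shows "linear_map_on B \<alpha>" "linear_map_on B \<beta>"
  using assms by (auto simp: splits_def k_positive_def k_copositive_def)

lemma splits_id: "unital_cstar_algebra B \<Longrightarrow> splits k B (\<lambda>x. x) (\<lambda>x. x) (\<lambda>x. 0)"
  by (auto simp: splits_def k_positive_def k_copositive_def linear_map_on_def tensor_identity_def
      tensor_transpose_def block_positive_def cstar_closed)

lemma splits_zero: "unital_cstar_algebra B \<Longrightarrow> splits k B (\<lambda>x. 0) (\<lambda>x. 0) (\<lambda>x. 0)"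
  by (auto simp: splits_def k_positive_def k_copositive_def linear_map_on_def tensor_identity_def
      tensor_transpose_def block_positive_def cstar_closed)

lemma splits_add:
  assumes B: "unital_cstar_algebra B" and "splits k B \<omega> \<alpha> \<beta>" "splits k B \<omega>' \<alpha>' \<beta>'"
  shows "splits k B (\<lambda>x. \<omega> x + \<omega>' x) (\<lambda>x. \<alpha> x + \<alpha>' x) (\<lambda>x. \<beta> x + \<beta>' x)"
  using assms splits_linear[OF assms(2)] splits_linear[OF assms(3)]
    block_positive_add[of k "tensor_identity \<alpha> _" "tensor_identity \<alpha>' _"]
    block_positive_add[of k "tensor_transpose \<beta> _" "tensor_transpose \<beta>' _"]
  by (simp add: splits_def k_positive_def k_copositive_def linear_map_on_add tensor_identity_def
      tensor_transpose_def algebra_simps)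

lemma splits_scaleR:
  assumes B: "unital_cstar_algebra B" and "splits k B \<omega> \<alpha> \<beta>" "0 \<le> r"
  shows "splits k B (\<lambda>x. r *\<^sub>R \<omega> x) (\<lambda>x. r *\<^sub>R \<alpha> x) (\<lambda>x. r *\<^sub>R \<beta> x)"
  using assms splits_linear[OF assms(2)]
    block_positive_scaleR[of k "tensor_identity \<alpha> _" r]
    block_positive_scaleR[of k "tensor_transpose \<beta> _" r]
  by (simp add: splits_def k_positive_def k_copositive_def linear_map_on_scaleR tensor_identity_def
      tensor_transpose_def scaleR_add_right)

lemma tensor_in_blocks:
  assumes "linear_map_on B \<psi>" "X \<in> block_matrices k B"
  shows "tensor_identity \<psi> X \<in> block_matrices k B" "tensor_transpose \<psi> X \<in> block_matrices k B"
  using assms by (auto simp: block_matrices_def tensor_identity_def tensor_transpose_def linear_map_onD)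

text \<open>
  The transposes cancel in a composition of two copositive maps, so the positive part of a
  composition collects the two unmixed terms and the copositive part the two mixed ones.
\<close>

lemma splits_comp:
  assumes B: "unital_cstar_algebra B" and s: "splits k B \<omega> \<alpha> \<beta>" and s': "splits k B \<omega>' \<alpha>' \<beta>'"
  shows "splits k B (\<lambda>x. \<omega> (\<omega>' x)) (\<lambda>x. \<alpha> (\<alpha>' x) + \<beta> (\<beta>' x)) (\<lambda>x. \<alpha> (\<beta>' x) + \<beta> (\<alpha>' x))"
proof -
  note lin = splits_linear[OF s] splits_linear[OF s']
  have pos: "block_positive k (tensor_identity \<alpha> X)" "block_positive k (tensor_transpose \<beta> X)"
    "block_positive k (tensor_identity \<alpha>' X)" "block_positive k (tensor_transpose \<beta>' X)"
    if "X \<in> block_matrices k B" "block_positive k X" for X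
    using s s' that by (auto simp: splits_def k_positive_def k_copositive_def)
  have "k_positive k B (\<lambda>x. \<alpha> (\<alpha>' x) + \<beta> (\<beta>' x))"
    unfolding k_positive_def
  proof (intro conjI ballI impI)
    fix X assume X: "X \<in> block_matrices k B" "block_positive k X"
    have "block_positive k (\<lambda>i j. tensor_identity \<alpha> (tensor_identity \<alpha>' X) i j
        + tensor_transpose \<beta> (tensor_transpose \<beta>' X) i j)"
      using X lin by (intro block_positive_add pos tensor_in_blocks)
    then show "block_positive k (tensor_identity (\<lambda>x. \<alpha> (\<alpha>' x) + \<beta> (\<beta>' x)) X)"
      by (simp add: tensor_identity_def tensor_transpose_def)
  qed (rule linear_map_on_add[OF B linear_map_on_comp[OF lin(1) lin(3)] linear_map_on_comp[OF lin(2) lin(4)]])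
  moreover have "k_copositive k B (\<lambda>x. \<alpha> (\<beta>' x) + \<beta> (\<alpha>' x))"
    unfolding k_copositive_def
  proof (intro conjI ballI impI)
    fix X assume X: "X \<in> block_matrices k B" "block_positive k X"
    have "block_positive k (\<lambda>i j. tensor_identity \<alpha> (tensor_transpose \<beta>' X) i j
        + tensor_transpose \<beta> (tensor_identity \<alpha>' X) i j)"
      using X lin by (intro block_positive_add pos tensor_in_blocks)
    then show "block_positive k (tensor_transpose (\<lambda>x. \<alpha> (\<beta>' x) + \<beta> (\<alpha>' x)) X)"
      by (simp add: tensor_identity_def tensor_transpose_def)
  qed (rule linear_map_on_add[OF B linear_map_on_comp[OF lin(1) lin(4)] linear_map_on_comp[OF lin(2) lin(3)]])
  moreover have "\<omega> (\<omega>' a) = \<alpha> (\<alpha>' a) + \<beta> (\<beta>' a) + (\<alpha> (\<beta>' a) + \<beta> (\<alpha>' a))" if a: "a \<in> B" for a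
  proof -
    have "\<alpha>' a \<in> B" "\<beta>' a \<in> B" using a lin by (auto intro: linear_map_onD)
    then show ?thesis
      using s s' a cstar_closed(2)[OF B] linear_map_onD(2)[OF lin(1)] linear_map_onD(2)[OF lin(2)]
      by (simp add: splits_def)
  qed
  ultimately show ?thesis by (simp add: splits_def)
qed

lemma splits_limit:
  assumes B: "unital_cstar_algebra B" and s: "\<And>n. splits k B (\<omega> n) (\<alpha> n) (\<beta> n)"
    and lim: "\<And>x. x \<in> B \<Longrightarrow> (\<lambda>n. \<alpha> n x) \<longlonglongrightarrow> \<alpha>' x" "\<And>x. x \<in> B \<Longrightarrow> (\<lambda>n. \<beta> n x) \<longlonglongrightarrow> \<beta>' x"
  shows "splits k B (\<lambda>x. \<alpha>' x + \<beta>' x) \<alpha>' \<beta>'"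
proof -
  have lin: "linear_map_on B \<psi>'"
    if l: "\<And>n. linear_map_on B (\<psi> n)" and lim: "\<And>x. x \<in> B \<Longrightarrow> (\<lambda>n. \<psi> n x) \<longlonglongrightarrow> \<psi>' x"
    for \<psi> :: "nat \<Rightarrow> complex^'a^'a \<Rightarrow> complex^'a^'a" and \<psi>'
    unfolding linear_map_on_def
  proof (intro conjI ballI allI image_subsetI)
    fix a assume a: "a \<in> B"
    show "\<psi>' a \<in> B"
      using closed_sequentially[OF closed_subspace[OF cstar_subspace[OF B]] _ lim[OF a]]
        linear_map_onD(1)[OF l a] by blast
    show "\<psi>' (mscale c a) = mscale c (\<psi>' a)" for c
    proof (rule LIMSEQ_unique)
      show "(\<lambda>n. \<psi> n (mscale c a)) \<longlonglongrightarrow> \<psi>' (mscale c a)"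
        by (rule lim[OF cstar_closed(4)[OF B a]])
      have "(\<lambda>n. mscale c (\<psi> n a)) \<longlonglongrightarrow> mscale c (\<psi>' a)"
        unfolding mscale_def by (intro tendsto_intros lim a)
      then show "(\<lambda>n. \<psi> n (mscale c a)) \<longlonglongrightarrow> mscale c (\<psi>' a)"
        by (simp add: linear_map_onD(3)[OF l a])
    qed
    fix b assume b: "b \<in> B"
    show "\<psi>' (a + b) = \<psi>' a + \<psi>' b"
    proof (rule LIMSEQ_unique)
      show "(\<lambda>n. \<psi> n (a + b)) \<longlonglongrightarrow> \<psi>' (a + b)"
        by (rule lim[OF cstar_closed(2)[OF B a b]])
      show "(\<lambda>n. \<psi> n (a + b)) \<longlonglongrightarrow> \<psi>' a + \<psi>' b"
        unfolding linear_map_onD(2)[OF l a b] by (intro tendsto_intros lim a b)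
    qed
  qed
  have "block_positive k (tensor_identity \<alpha>' X)" "block_positive k (tensor_transpose \<beta>' X)"
    if X: "X \<in> block_matrices k B" "block_positive k X" for X
  proof -
    have "block_positive k (tensor_identity (\<alpha> n) X)" "block_positive k (tensor_transpose (\<beta> n) X)" for n
      using s[of n] X by (auto simp: splits_def k_positive_def k_copositive_def)
    moreover have "(\<lambda>n. tensor_identity (\<alpha> n) X i j) \<longlonglongrightarrow> tensor_identity \<alpha>' X i j"
      "(\<lambda>n. tensor_transpose (\<beta> n) X i j) \<longlonglongrightarrow> tensor_transpose \<beta>' X i j" if "i < k" "j < k" for i j
      using X that by (auto simp: tensor_identity_def tensor_transpose_def block_matrices_def intro!: lim)
    ultimately show "block_positive k (tensor_identity \<alpha>' X)" "block_positive k (tensor_transpose \<beta>' X)"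
      by - (rule block_positive_limit; assumption)+
  qed
  then show ?thesis
    using lin[OF splits_linear(1)[OF s] lim(1)] lin[OF splits_linear(2)[OF s] lim(2)]
    by (simp add: splits_def k_positive_def k_copositive_def)
qed

lemma splits_schwarz_decomposition:
  assumes B: "unital_cstar_algebra B" and s: "splits 2 B \<omega> \<alpha> \<beta>"
    and "\<omega> (mat 1) = mat 1" "\<And>a. a \<in> B \<Longrightarrow> trace (\<omega> a) = trace a"
  shows "schwarz_decomposition B \<omega> \<alpha> \<beta>"
  using assms k_positive_2_schwarz[OF B] k_copositive_2_schwarz[OF B]
  by (simp add: schwarz_decomposition_def splits_def)

section \<open>Compactness\<close>

lemma norm_matrix_le:
  assumes "\<And>i j. cmod (a $ i $ j) \<le> K"
  shows "norm (a :: complex^'n^'n) \<le> real CARD('n) * (real CARD('n) * K)"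
proof -
  have "norm a \<le> (\<Sum>i\<in>UNIV. norm (a $ i))"
    unfolding norm_vec_def[of a] by (rule L2_set_le_sum) simp
  also have "\<dots> \<le> (\<Sum>i::'n\<in>UNIV. \<Sum>j::'n\<in>UNIV. K)"
  proof (rule sum_mono)
    fix i
    have "norm (a $ i) \<le> (\<Sum>j\<in>UNIV. norm (a $ i $ j))"
      unfolding norm_vec_def[of "a $ i"] by (rule L2_set_le_sum) simp
    also have "\<dots> \<le> (\<Sum>j::'n\<in>UNIV. K)"
      by (intro sum_mono assms)
    finally show "norm (a $ i) \<le> (\<Sum>j::'n\<in>UNIV. K)" .
  qed
  finally show ?thesis by simp
qed

text \<open>
  The form is nonnegative at \<open>\<xi> = e\<^sub>j\<close> and \<open>\<eta> = u e\<^sub>i\<close>, where the phase \<open>u\<close> is chosen to make the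
  two cross terms equal to \<open>-\<bar>\<psi>(x)\<^sub>i\<^sub>j\<bar>\<close>.
\<close>

lemma schwarz_map_entry_bound:
  assumes S: "schwarz_map mu B \<psi>" and B: "unital_cstar_algebra B" and x: "x \<in> B"
  shows "2 * cmod (\<psi> x $ i $ j) \<le> Re (trace (\<psi> (mu (mstar x) x))) + Re (trace (\<psi> (mat 1)))"
proof -
  define z u where "z = \<psi> x $ i $ j" and "u = - sgn z"
  have u: "cnj u * z = - of_real (cmod z)"
  proof (cases "z = 0")
    case False
    have "cnj z * z = of_real (cmod z) * of_real (cmod z)"
      by (metis complex_norm_square mult.commute of_real_mult power2_eq_square)
    then show ?thesis using False by (simp add: u_def sgn_div_norm scaleR_conv_of_real divide_simps)
  qed (simp add: u_def)
  have uu: "u * cnj u * of_real r = (if z = 0 then 0 else of_real r)" for r :: real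
    by (auto simp: u_def sgn_div_norm scaleR_conv_of_real complex_norm_square[symmetric]
        power2_eq_square divide_simps mult.commute)
  have diag: "Re (p $ i $ i) \<le> Re (trace p)" "0 \<le> Re (p $ i $ i)" if p: "positive_op p" for p :: "complex^'a^'a" and i
  proof -
    have nonneg: "0 \<le> Re (p $ l $ l)" for l
      using positive_op_diag[OF p, of l] by (simp add: complex_nonneg_Reals_iff)
    then show "0 \<le> Re (p $ i $ i)" .
    have "Re (p $ i $ i) \<le> (\<Sum>l\<in>UNIV. Re (p $ l $ l))"
      by (intro member_le_sum) (auto simp: nonneg)
    then show "Re (p $ i $ i) \<le> Re (trace p)" by (simp add: trace_def)
  qed
  have pos: "positive_op (\<psi> (mu (mstar x) x))" "positive_op (\<psi> (mat 1))"
    by (rule schwarz_map_positive_op[OF S x], rule schwarz_map_unit[OF S B])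
  have "schwarz_form mu \<psi> x (axis j 1) (u *s axis i 1) \<in> \<real>\<^sub>\<ge>\<^sub>0"
    using S x by (auto simp: schwarz_map_def)
  moreover have "schwarz_form mu \<psi> x (axis j 1) (u *s axis i 1)
      = \<psi> (mu (mstar x) x) $ j $ j + cnj (cnj u * z) + cnj u * z + u * cnj u * \<psi> (mat 1) $ i $ i"
    by (simp add: schwarz_form_def matrix_scale_apply hinner_scale hinner_axis schwarz_map_mstar[OF S B x] z_def ac_simps)
  ultimately have "2 * cmod z \<le> Re (\<psi> (mu (mstar x) x) $ j $ j) + Re (u * cnj u * \<psi> (mat 1) $ i $ i)"
    unfolding u by (simp add: complex_nonneg_Reals_iff)
  moreover have "Re (u * cnj u * \<psi> (mat 1) $ i $ i) \<le> Re (\<psi> (mat 1) $ i $ i)"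
  proof -
    have "\<psi> (mat 1) $ i $ i = of_real (Re (\<psi> (mat 1) $ i $ i))"
      using positive_op_diag[OF pos(2), of i] by (simp add: complex_nonneg_Reals_iff complex_eq_iff)
    then have "Re (u * cnj u * \<psi> (mat 1) $ i $ i) = (if z = 0 then 0 else Re (\<psi> (mat 1) $ i $ i))"
      by (metis Re_complex_of_real uu zero_complex.sel(1))
    then show ?thesis using diag(2)[OF pos(2), of i] by simp
  qed
  ultimately show ?thesis
    using diag(1)[OF pos(1), of j] diag(1)[OF pos(2), of i] by (simp add: z_def)
qed

context schwarz_decomposition
begin

text \<open>
  The bound depends on \<open>x\<close> and the dimension but not on the map, because the trace is preserved and
  each summand takes \<open>x\<^sup>*x\<close> and \<open>x x\<^sup>*\<close> to positive operators of no larger trace.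
\<close>

lemma parts_norm_bound:
  assumes x: "x \<in> B"
  defines "K \<equiv> real CARD('n) * (real CARD('n) * ((norm x)\<^sup>2 + real CARD('n)))"
  shows "norm (\<phi>1 x) \<le> K" "norm (\<phi>2 x) \<le> K" "norm (\<phi> x) \<le> 2 * K"
proof -
  have tr: "Re (trace (\<phi>1 y)) \<le> Re (trace y)" if "y \<in> B" "positive_op (\<phi>2 y)" for y
    using trace_preserving[OF that(1)] positive_op_trace[OF that(2)] that(1)
    by (auto simp: decomp trace_add complex_nonneg_Reals_iff dest: arg_cong[where f = Re])
  have tr': "Re (trace (\<phi>2 y)) \<le> Re (trace y)" if "y \<in> B" "positive_op (\<phi>1 y)" for y
    using trace_preserving[OF that(1)] positive_op_trace[OF that(2)] that(1)
    by (auto simp: decomp trace_add complex_nonneg_Reals_iff dest: arg_cong[where f = Re])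
  have sq: "Re (trace (mstar x ** x)) = (norm x)\<^sup>2" "Re (trace (x ** mstar x)) = (norm x)\<^sup>2"
    "Re (trace (mat 1 :: complex^'n^'n)) = real CARD('n)"
    by (simp_all add: trace_mult_mstar trace_mul_sym[of "mstar x"]) (simp add: trace_def mat_def)
  have "2 * cmod (\<phi>1 x $ i $ j) \<le> (norm x)\<^sup>2 + real CARD('n)" for i j
    using schwarz_map_entry_bound[OF S1 B x, of i j]
      tr[of "mstar x ** x"] tr[of "mat 1"] schwarz_map_positive_op[OF S2, of "mstar x"]
      schwarz_map_unit[OF S2 B] x closed sq by simp
  then have "cmod (\<phi>1 x $ i $ j) \<le> (norm x)\<^sup>2 + real CARD('n)" for i j
    using norm_ge_zero[of "\<phi>1 x $ i $ j"] by (smt (verit))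
  then show 1: "norm (\<phi>1 x) \<le> K" unfolding K_def by (rule norm_matrix_le)
  have "2 * cmod (\<phi>2 x $ i $ j) \<le> (norm x)\<^sup>2 + real CARD('n)" for i j
    using schwarz_map_entry_bound[OF S2 B x, of i j]
      tr'[of "x ** mstar x"] tr'[of "mat 1"] schwarz_map_positive_op[OF S1, of "mstar x"]
      schwarz_map_unit[OF S1 B] x closed sq by simp
  then have "cmod (\<phi>2 x $ i $ j) \<le> (norm x)\<^sup>2 + real CARD('n)" for i j
    using norm_ge_zero[of "\<phi>2 x $ i $ j"] by (smt (verit))
  then show 2: "norm (\<phi>2 x) \<le> K" unfolding K_def by (rule norm_matrix_le)
  show "norm (\<phi> x) \<le> 2 * K"
    using 1 2 norm_triangle_ineq[of "\<phi>1 x" "\<phi>2 x"] by (simp add: decomp x)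
qed

end

text \<open>
  Nothing is known about \<open>\<psi>\<close> off \<open>B\<close>, so its continuity is expressed by its graph over \<open>B\<close>: a finite
  dimensional subspace, hence closed.
\<close>

lemma linear_map_on_graph_closed:
  assumes B: "unital_cstar_algebra B" and \<psi>: "linear_map_on B \<psi>"
    and f: "\<And>n. f n \<in> B" "f \<longlonglongrightarrow> l" "(\<lambda>n. \<psi> (f n)) \<longlonglongrightarrow> m"
  shows "l \<in> B" "\<psi> l = m"
proof -
  let ?G = "(\<lambda>x. (x, \<psi> x)) ` B"
  have "\<psi> 0 = 0" using linear_map_onD(3)[OF \<psi> cstar_closed(7)[OF B], of 0] by simp
  then have "subspace ?G"
    unfolding subspace_def using cstar_closed[OF B] linear_map_onD[OF \<psi>]
    by (auto simp: image_iff zero_prod_def scaleR_mscale[of _ "\<psi> _"]) (simp_all add: scaleR_mscale)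
  then have "closed ?G" by (rule closed_subspace)
  moreover have "(\<lambda>n. (f n, \<psi> (f n))) \<longlonglongrightarrow> (l, m)" by (intro tendsto_Pair f)
  ultimately have "(l, m) \<in> ?G" using closed_sequentially[of ?G "\<lambda>n. (f n, \<psi> (f n))"] f(1) by blast
  then show "l \<in> B" "\<psi> l = m" by auto
qed

text \<open>
  Linear combinations preserve convergence, so it suffices to pass to a subsequence that converges
  on a finite set spanning \<open>B\<close>.
\<close>

lemma linear_maps_convergent_subsequence:
  fixes \<psi> :: "nat \<Rightarrow> complex^'n^'n \<Rightarrow> 'b :: euclidean_space"
  assumes B: "unital_cstar_algebra B"
    and add: "\<And>n x y. x \<in> B \<Longrightarrow> y \<in> B \<Longrightarrow> \<psi> n (x + y) = \<psi> n x + \<psi> n y"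
    and scale: "\<And>n r x. x \<in> B \<Longrightarrow> \<psi> n (r *\<^sub>R x) = r *\<^sub>R \<psi> n x"
    and bound: "\<And>n x. x \<in> B \<Longrightarrow> norm (\<psi> n x) \<le> K x"
  obtains r where "strict_mono r" "\<And>x. x \<in> B \<Longrightarrow> convergent (\<lambda>n. \<psi> (r n) x)"
proof -
  obtain S where S: "finite S" "S \<subseteq> B" "span S = B"
    using basis_subspace_exists[OF cstar_subspace[OF B]] by metis
  have "norm (\<psi> n x) \<le> (\<Sum>x\<in>S. \<bar>K x\<bar>)" if "x \<in> S" for n x
  proof -
    have "norm (\<psi> n x) \<le> \<bar>K x\<bar>" using bound[of x n] that S by auto
    also have "\<dots> \<le> (\<Sum>x\<in>S. \<bar>K x\<bar>)" by (rule member_le_sum) (use S that in auto)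
    finally show ?thesis .
  qed
  from function_convergent_subsequence[where f = \<psi>, OF countable_finite[OF S(1)] this]
  obtain r where r: "strict_mono r" "\<And>x. x \<in> S \<Longrightarrow> \<exists>l. (\<lambda>n. \<psi> (r n) x) \<longlonglongrightarrow> l" by blast
  have z: "\<psi> n 0 = 0" for n
    using scale[OF cstar_closed(7)[OF B], of n 0] by simp
  have conv_scale: "convergent (\<lambda>n. c *\<^sub>R g n)" if "convergent g" for c and g :: "nat \<Rightarrow> 'b"
    using that unfolding convergent_def by (blast intro: tendsto_scaleR[OF tendsto_const])
  have "subspace {x \<in> B. convergent (\<lambda>n. \<psi> (r n) x)}"
    unfolding subspace_def using cstar_closed[OF B]
    by (auto simp: add scale z convergent_const intro!: convergent_add conv_scale)
  moreover have "S \<subseteq> {x \<in> B. convergent (\<lambda>n. \<psi> (r n) x)}"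
    using r S by (auto simp: convergent_def)
  ultimately have "B \<subseteq> {x \<in> B. convergent (\<lambda>n. \<psi> (r n) x)}"
    using span_minimal S(3) by metis
  then show thesis using that r by blast
qed

section \<open>The invariant projection as a limit of averages\<close>

fun orbit_sum :: "('a \<Rightarrow> 'a) \<Rightarrow> nat \<Rightarrow> 'a \<Rightarrow> 'a :: monoid_add" where
  "orbit_sum f 0 x = 0"
| "orbit_sum f (Suc n) x = x + f (orbit_sum f n x)"

definition cesaro :: "(complex^'n^'n \<Rightarrow> complex^'n^'n) \<Rightarrow> nat \<Rightarrow> complex^'n^'n \<Rightarrow> complex^'n^'n" where
  "cesaro \<phi> n x = (1 / real (Suc n)) *\<^sub>R orbit_sum \<phi> (Suc n) x"

lemma splits_iterate:
  assumes B: "unital_cstar_algebra B" and "splits k B \<phi> \<phi>1 \<phi>2"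
  shows "\<exists>\<alpha> \<beta>. splits k B (\<phi> ^^ n) \<alpha> \<beta>"
proof (induction n)
  case 0
  show ?case using splits_id[OF B, of k] by (auto simp: id_def)
next
  case (Suc n)
  then obtain \<alpha> \<beta> where "splits k B (\<phi> ^^ n) \<alpha> \<beta>" by blast
  from splits_comp[OF B assms(2) this] show ?case by (auto simp: comp_def)
qed

lemma splits_cesaro:
  assumes B: "unital_cstar_algebra B" and s: "splits k B \<phi> \<phi>1 \<phi>2"
  shows "\<exists>\<alpha> \<beta>. splits k B (cesaro \<phi> n) \<alpha> \<beta>"
proof -
  have "\<exists>\<alpha> \<beta>. splits k B (orbit_sum \<phi> m) \<alpha> \<beta>" for m
  proof (induction m)
    case 0
    have "orbit_sum \<phi> 0 = (\<lambda>x. 0)" by auto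
    then show ?case using splits_zero[OF B, of k] by auto
  next
    case (Suc m)
    then obtain \<alpha> \<beta> where "splits k B (orbit_sum \<phi> m) \<alpha> \<beta>" by blast
    from splits_add[OF B splits_id[OF B] splits_comp[OF B s this]]
    have "\<exists>\<alpha> \<beta>. splits k B (\<lambda>x. x + \<phi> (orbit_sum \<phi> m x)) \<alpha> \<beta>" by blast
    moreover have "orbit_sum \<phi> (Suc m) = (\<lambda>x. x + \<phi> (orbit_sum \<phi> m x))" by auto
    ultimately show ?case by simp
  qed
  then obtain \<alpha> \<beta> where "splits k B (orbit_sum \<phi> (Suc n)) \<alpha> \<beta>" by blast
  from splits_scaleR[OF B this, of "1 / real (Suc n)"]
  have "\<exists>\<alpha> \<beta>. splits k B (\<lambda>x. (1 / real (Suc n)) *\<^sub>R orbit_sum \<phi> (Suc n) x) \<alpha> \<beta>" by auto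
  moreover have "cesaro \<phi> n = (\<lambda>x. (1 / real (Suc n)) *\<^sub>R orbit_sum \<phi> (Suc n) x)"
    by (rule ext) (rule cesaro_def)
  ultimately show ?thesis by (simp only:)
qed

context schwarz_decomposition
begin

lemma orbit_sum_in: "x \<in> B \<Longrightarrow> orbit_sum \<phi> n x \<in> B"
  by (induction n) (simp_all add: closed map_linear)

lemma iterate_props:
  assumes "x \<in> B"
  shows "(\<phi> ^^ n) x \<in> B" "trace ((\<phi> ^^ n) x) = trace x"
  using assms by (induction n) (simp_all add: map_linear trace_preserving)

lemma iterate_unit: "(\<phi> ^^ n) (mat 1) = mat 1"
  by (induction n) (simp_all add: unital)

lemma orbit_sum_unit: "orbit_sum \<phi> n (mat 1) = real n *\<^sub>R mat 1"
  by (induction n) (simp_all add: map_linear(5)[OF closed(1)] unital scaleR_add_left)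

lemma orbit_sum_trace: "x \<in> B \<Longrightarrow> trace (orbit_sum \<phi> n x) = of_nat n * trace x"
  by (induction n)
    (simp_all add: trace_add trace_preserving orbit_sum_in algebra_simps)

lemma map_diff: "a \<in> B \<Longrightarrow> b \<in> B \<Longrightarrow> \<phi> (a - b) = \<phi> a - \<phi> b"
  using linear_map_on_diff[OF _ B, of \<phi> a b] map_linear by (auto simp: linear_map_on_def)

text \<open>Telescoping: applying \<open>\<phi>\<close> shifts the orbit sum by one step.\<close>

lemma map_orbit_sum: "x \<in> B \<Longrightarrow> \<phi> (orbit_sum \<phi> n x) = orbit_sum \<phi> n x + (\<phi> ^^ n) x - x"
proof (induction n)
  case 0
  have "\<phi> 0 = 0" using map_linear(5)[OF closed(1), of 0] by simp
  then show ?case by simp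
next
  case (Suc n)
  have "\<phi> (\<phi> (orbit_sum \<phi> n x)) = \<phi> (orbit_sum \<phi> n x + (\<phi> ^^ n) x - x)"
    by (simp add: Suc)
  also have "\<dots> = \<phi> (orbit_sum \<phi> n x) + \<phi> ((\<phi> ^^ n) x) - \<phi> x"
    using Suc.prems by (simp add: map_diff map_linear closed orbit_sum_in iterate_props)
  finally show ?case
    using Suc.prems by (simp add: map_linear closed orbit_sum_in)
qed

lemma cesaro_in: "x \<in> B \<Longrightarrow> cesaro \<phi> n x \<in> B"
  by (simp only: cesaro_def closed orbit_sum_in)

lemma cesaro_unit: "cesaro \<phi> n (mat 1) = mat 1"
  unfolding cesaro_def orbit_sum_unit by simp

lemma trace_scaleR: "trace (r *\<^sub>R (a :: complex^'n^'n)) = of_real r * trace a"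
  by (simp add: scaleR_mscale trace_mscale)

lemma cesaro_trace: "x \<in> B \<Longrightarrow> trace (cesaro \<phi> n x) = trace x"
  unfolding cesaro_def trace_scaleR by (simp only: orbit_sum_trace) (simp del: of_nat_Suc)

lemma cesaro_almost_fixed:
  assumes bound: "\<And>n. norm ((\<phi> ^^ n) x) \<le> K" and x: "x \<in> B"
  shows "(\<lambda>n. \<phi> (cesaro \<phi> n x) - cesaro \<phi> n x) \<longlonglongrightarrow> 0"
proof (rule Lim_null_comparison)
  have "\<phi> (cesaro \<phi> n x) - cesaro \<phi> n x = (1 / real (Suc n)) *\<^sub>R ((\<phi> ^^ Suc n) x - x)" for n
    unfolding cesaro_def map_linear(5)[OF orbit_sum_in[OF x]] map_orbit_sum[OF x]
    by (simp only: scaleR_diff_right[symmetric]) simp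
  moreover have "norm ((\<phi> ^^ Suc n) x - x) \<le> K + norm x" for n
    using norm_triangle_ineq4[of "(\<phi> ^^ Suc n) x" x] bound[of "Suc n"] by linarith
  ultimately show "\<forall>\<^sub>F n in sequentially. norm (\<phi> (cesaro \<phi> n x) - cesaro \<phi> n x) \<le> inverse (real (Suc n)) * (K + norm x)"
    by (simp add: mult_left_mono divide_inverse del: of_nat_Suc funpow.simps)
  show "(\<lambda>n. inverse (real (Suc n)) * (K + norm x)) \<longlonglongrightarrow> 0"
    using tendsto_mult_right[OF LIMSEQ_inverse_real_of_nat, of "K + norm x"] by simp
qed

lemma invariant_cesaro:
  assumes P: "linear_map_on B P" and inv: "\<And>x. x \<in> B \<Longrightarrow> P (\<phi> x) = P x" and x: "x \<in> B"
  shows "P (cesaro \<phi> n x) = P x"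
proof -
  have scale: "P (r *\<^sub>R y) = r *\<^sub>R P y" if "y \<in> B" for r y
    using linear_map_onD(3)[OF P that] by (simp add: scaleR_mscale)
  have "P (orbit_sum \<phi> m x) = real m *\<^sub>R P x" for m
  proof (induction m)
    case 0
    show ?case using scale[OF closed(1), of 0] by simp
  next
    case (Suc m)
    then show ?case
      using x by (simp add: linear_map_onD(2)[OF P] orbit_sum_in map_linear inv scaleR_add_left)
  qed
  then show ?thesis
    unfolding cesaro_def using x by (simp only: scale orbit_sum_in) simp
qed

end

text \<open>
  The averages split with uniformly bounded parts, so a subsequence of the split parts converges.
  The limit of the averages along it is fixed by \<open>\<phi>\<close> and has the same image under \<open>P\<close>; since \<open>P\<close> is
  the identity on fixed points, this limit is \<open>P\<close>.
\<close>

lemma invariant_projection_schwarz_decomposition: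
  fixes B :: "(complex^'n^'n) set"
  assumes B: "unital_cstar_algebra B" and s: "splits 2 B \<phi> \<phi>1 \<phi>2" and unital: "\<phi> (mat 1) = mat 1"
    and trace: "\<And>a. a \<in> B \<Longrightarrow> trace (\<phi> a) = trace a" and P: "invariant_projection B \<phi> P"
  shows "\<exists>P1 P2. schwarz_decomposition B P P1 P2"
proof -
  interpret schwarz_decomposition B \<phi> \<phi>1 \<phi>2
    by (rule splits_schwarz_decomposition[OF B s unital trace])
  have P_lin: "linear_map_on B P" and P_unit: "P (mat 1) = mat 1"
    and P_idem: "\<And>a. a \<in> B \<Longrightarrow> P (P a) = P a" and P_range: "P ` B = fixed_points B \<phi>"
    and P_inv: "\<And>a. a \<in> B \<Longrightarrow> P (\<phi> a) = P a"
    using P by (auto simp: invariant_projection_def projection_map_def positive_map_def)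
  define K where "K x = real CARD('n) * (real CARD('n) * ((norm x)\<^sup>2 + real CARD('n)))"
    for x :: "complex^'n^'n"
  have bounded: "norm ((\<phi> ^^ n) x) \<le> 2 * K x" if x: "x \<in> B" for n x
  proof -
    obtain \<alpha> \<beta> where "splits 2 B (\<phi> ^^ n) \<alpha> \<beta>" using splits_iterate[OF B s] by blast
    then interpret it: schwarz_decomposition B "\<phi> ^^ n" \<alpha> \<beta>
      by (rule splits_schwarz_decomposition[OF B _ iterate_unit iterate_props(2)])
    show ?thesis unfolding K_def by (rule it.parts_norm_bound(3)[OF x])
  qed
  have "\<forall>n. \<exists>\<alpha> \<beta>. splits 2 B (cesaro \<phi> n) \<alpha> \<beta>" using splits_cesaro[OF B s] by blast
  then obtain \<alpha> \<beta> where ab: "\<And>n. splits 2 B (cesaro \<phi> n) (\<alpha> n) (\<beta> n)" by metis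
  have ab_bound: "norm (\<alpha> n x) \<le> K x" "norm (\<beta> n x) \<le> K x" if x: "x \<in> B" for n x
  proof -
    interpret av: schwarz_decomposition B "cesaro \<phi> n" "\<alpha> n" "\<beta> n"
      by (rule splits_schwarz_decomposition[OF B ab cesaro_unit cesaro_trace])
    show "norm (\<alpha> n x) \<le> K x" "norm (\<beta> n x) \<le> K x"
      unfolding K_def by (rule av.parts_norm_bound[OF x])+
  qed
  note ab_lin = splits_linear[OF ab]
  obtain r where r: "strict_mono r" "\<And>x. x \<in> B \<Longrightarrow> convergent (\<lambda>n. (\<alpha> (r n) x, \<beta> (r n) x))"
  proof (rule linear_maps_convergent_subsequence[OF B, where \<psi> = "\<lambda>n x. (\<alpha> n x, \<beta> n x)" and K = "\<lambda>x. K x + K x"])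
    show "(\<alpha> n (x + y), \<beta> n (x + y)) = (\<alpha> n x, \<beta> n x) + (\<alpha> n y, \<beta> n y)" if "x \<in> B" "y \<in> B" for n x y
      using that by (simp add: linear_map_onD(2)[OF ab_lin(1)] linear_map_onD(2)[OF ab_lin(2)])
    show "(\<alpha> n (c *\<^sub>R x), \<beta> n (c *\<^sub>R x)) = c *\<^sub>R (\<alpha> n x, \<beta> n x)" if "x \<in> B" for n c x
      using that by (simp add: scaleR_mscale linear_map_onD(3)[OF ab_lin(1)] linear_map_onD(3)[OF ab_lin(2)])
    show "norm (\<alpha> n x, \<beta> n x) \<le> K x + K x" if "x \<in> B" for n x
      using norm_Pair_le[of "\<alpha> n x" "\<beta> n x"] ab_bound[OF that, of n] by linarith
  qed blast
  define P1 P2 where "P1 x = lim (\<lambda>n. \<alpha> (r n) x)" and "P2 x = lim (\<lambda>n. \<beta> (r n) x)" for x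
  have lims: "(\<lambda>n. \<alpha> (r n) x) \<longlonglongrightarrow> P1 x" "(\<lambda>n. \<beta> (r n) x) \<longlonglongrightarrow> P2 x" if x: "x \<in> B" for x
  proof -
    obtain l where l: "(\<lambda>n. (\<alpha> (r n) x, \<beta> (r n) x)) \<longlonglongrightarrow> l"
      using r(2)[OF x] by (auto simp: convergent_def)
    show "(\<lambda>n. \<alpha> (r n) x) \<longlonglongrightarrow> P1 x" "(\<lambda>n. \<beta> (r n) x) \<longlonglongrightarrow> P2 x"
      using tendsto_fst[OF l] tendsto_snd[OF l] by (simp_all add: P1_def P2_def limI)
  qed
  have P12: "splits 2 B (\<lambda>x. P1 x + P2 x) P1 P2"
    by (rule splits_limit[OF B ab lims])
  have cesaro_lim: "(\<lambda>n. cesaro \<phi> (r n) x) \<longlonglongrightarrow> P1 x + P2 x" if x: "x \<in> B" for x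
  proof -
    have "cesaro \<phi> (r n) x = \<alpha> (r n) x + \<beta> (r n) x" for n
      using ab[of "r n"] x by (simp add: splits_def)
    then show ?thesis using tendsto_add[OF lims[OF x]] by simp
  qed
  have P_eq: "P x = P1 x + P2 x" if x: "x \<in> B" for x
  proof -
    define q where "q = P1 x + P2 x"
    note q_lim = cesaro_lim[OF x, folded q_def]
    have "(\<lambda>n. \<phi> (cesaro \<phi> (r n) x) - cesaro \<phi> (r n) x) \<longlonglongrightarrow> 0"
      using LIMSEQ_subseq_LIMSEQ[OF cesaro_almost_fixed[OF bounded[OF x] x] r(1)] by (simp add: comp_def)
    from tendsto_add[OF this q_lim] have "(\<lambda>n. \<phi> (cesaro \<phi> (r n) x)) \<longlonglongrightarrow> q" by simp
    moreover have "linear_map_on B \<phi>" using map_linear by (auto simp: linear_map_on_def)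
    ultimately have q: "q \<in> B" "\<phi> q = q"
      using linear_map_on_graph_closed[OF B _ cesaro_in[OF x] q_lim] by blast+
    then have "q \<in> P ` B" using P_range by (simp add: fixed_points_def)
    then have "P q = q" using P_idem by auto
    moreover have "P q = P x"
      using linear_map_on_graph_closed(2)[OF B P_lin cesaro_in[OF x] q_lim]
      by (simp add: invariant_cesaro[OF P_lin P_inv x])
    ultimately show ?thesis by (simp add: q_def)
  qed
  have P_trace: "trace (P x) = trace x" if x: "x \<in> B" for x
  proof (rule LIMSEQ_unique)
    show "(\<lambda>n. trace (cesaro \<phi> (r n) x)) \<longlonglongrightarrow> trace (P x)"
      unfolding P_eq[OF x] trace_def by (intro tendsto_intros cesaro_lim x)
    show "(\<lambda>n. trace (cesaro \<phi> (r n) x)) \<longlonglongrightarrow> trace x"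
      by (simp add: cesaro_trace x)
  qed
  have "splits 2 B P P1 P2" using P12 P_eq by (simp add: splits_def)
  from splits_schwarz_decomposition[OF B this P_unit P_trace] show ?thesis by blast
qed

section \<open>Decomposability and reversibility\<close>

theorem theorem8:
  fixes B :: "(complex ^ 'n ^ 'n) set"
    and \<phi> :: "complex ^ 'n ^ 'n \<Rightarrow> complex ^ 'n ^ 'n"
  assumes "unital_cstar_algebra B"
    and "positive_map B \<phi>"
    and "\<phi> (mat 1) = mat 1"
    and "\<forall>a\<in>B. trace (\<phi> a) = trace a"
  shows "(two_two_decomposable B \<phi> \<longrightarrow>
            (\<forall>P. invariant_projection B \<phi> P \<longrightarrow> decomposable B P) \<and>
            jordan_subalgebra B (self_adjoint_part (fixed_points B \<phi>)) \<and>
            reversible (self_adjoint_part (fixed_points B \<phi>)))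
       \<and> (\<not> reversible (self_adjoint_part (fixed_points B \<phi>)) \<longrightarrow> atomic_map B \<phi>)"
proof -
  have "(\<forall>P. invariant_projection B \<phi> P \<longrightarrow> decomposable B P) \<and>
      jordan_subalgebra B (self_adjoint_part (fixed_points B \<phi>)) \<and>
      reversible (self_adjoint_part (fixed_points B \<phi>))" if dec: "two_two_decomposable B \<phi>"
  proof -
    obtain \<phi>1 \<phi>2 where s: "splits 2 B \<phi> \<phi>1 \<phi>2"
      using dec by (auto simp: two_two_decomposable_def splits_def)
    interpret schwarz_decomposition B \<phi> \<phi>1 \<phi>2
      using assms by (intro splits_schwarz_decomposition s) auto
    have "decomposable B P" if P: "invariant_projection B \<phi> P" for P
    proof -
      obtain P1 P2 where P12: "schwarz_decomposition B P P1 P2"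
        using invariant_projection_schwarz_decomposition[OF assms(1) s assms(3) _ P] assms(4) by blast
      show ?thesis
        using P by (intro schwarz_decomposition.idempotent_decomposable[OF P12])
          (auto simp: invariant_projection_def projection_map_def)
    qed
    then show ?thesis using jordan_fixed_points reversible_fixed_points by blast
  qed
  then show ?thesis using assms(2) by (auto simp: atomic_map_def)
qed

end
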